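(* Let $W=\{z\in\mathbb{C}:-1<\operatorname{Re}(z)<1,\ \operatorname{Im}(z)>0\}$, let $\alpha\in(-1,1)$, $\beta>0$, and let $T_W$ be the exit time from $W$ of a planar Brownian motion started at $\alpha+\beta i$. Then for $x\in(-1,1)$ the density of $B_{T_W}$ with respect to arclength at the boundary point $x$ is $$\rho^{\alpha+\beta i}_{T_W}(x)=\frac1\pi\sum_{n=-\infty}^{\infty}(-1)^n\frac{\beta}{\beta^2+\big(\alpha-(2n+(-1)^nx)\big)^2},$$ and it is also equal to $$\frac12\cdot\frac{\sinh(\frac{\pi\beta}2)\cos(\frac{\pi\alpha}2)\cos(\frac{\pi x}2)}{\sinh^2(\frac{\pi\beta}2)+\sin^2(\frac{\pi\alpha}2)+\sin^2(\frac{\pi x}2)-2\cosh(\frac{\pi\beta}2)\sin(\frac{\pi\alpha}2)\sin(\frac{\pi x}2)}.$$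
   Context: For a domain $U$, $T_U=\inf\{t\ge0:B_t\notin U\}$, and $\rho^a_{T_U}$ denotes the density of $B_{T_U}$ with respect to arclength on the boundary when $B_0=a$. *)

theory Defs
  imports "HOL-Probability.Probability"
begin

(* Every path is continuous, not only almost every one, so that exit times and exit
   positions are measurable without completing M. *)
locale planar_brownian_motion = prob_space M for M :: "'w measure" +
  fixes B :: "real \<Rightarrow> 'w \<Rightarrow> complex" and a :: complex
  assumes measurable_B: "\<And>t. 0 \<le> t \<Longrightarrow> random_variable borel (B t)"
    and start: "AE \<omega> in M. B 0 \<omega> = a"
    and continuous_paths: "\<And>\<omega>. \<omega> \<in> space M \<Longrightarrow> continuous_on {0..} (\<lambda>t. B t \<omega>)"
    and indep_increments: "\<And>(t :: nat \<Rightarrow> real) n. 0 \<le> t 0 \<Longrightarrow> (\<And>i. i < n \<Longrightarrow> t i \<le> t (Suc i)) \<Longrightarrow>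
          indep_vars (\<lambda>_. borel) (\<lambda>i \<omega>. B (t (Suc i)) \<omega> - B (t i) \<omega>) {..<n}"
    and Re_increment: "\<And>s t. 0 \<le> s \<Longrightarrow> s < t \<Longrightarrow>
          distributed M lborel (\<lambda>\<omega>. Re (B t \<omega> - B s \<omega>)) (normal_density 0 (sqrt (t - s)))"
    and Im_increment: "\<And>s t. 0 \<le> s \<Longrightarrow> s < t \<Longrightarrow>
          distributed M lborel (\<lambda>\<omega>. Im (B t \<omega> - B s \<omega>)) (normal_density 0 (sqrt (t - s)))"
    and indep_Re_Im: "\<And>s t. 0 \<le> s \<Longrightarrow> s < t \<Longrightarrow>
          indep_var borel (\<lambda>\<omega>. Re (B t \<omega> - B s \<omega>)) borel (\<lambda>\<omega>. Im (B t \<omega> - B s \<omega>))"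

(* The infimum is taken in ereal, so a path that never leaves U has exit time \<infinity>. *)
definition exit_time :: "(real \<Rightarrow> 'w \<Rightarrow> complex) \<Rightarrow> complex set \<Rightarrow> 'w \<Rightarrow> ereal" where
  "exit_time B U \<omega> = Inf {ereal t | t. 0 \<le> t \<and> B t \<omega> \<notin> U}"

(* Meaningful only where the exit time is finite. *)
definition exit_point :: "(real \<Rightarrow> 'w \<Rightarrow> complex) \<Rightarrow> complex set \<Rightarrow> 'w \<Rightarrow> complex" where
  "exit_point B U \<omega> = B (real_of_ereal (exit_time B U \<omega>)) \<omega>"

definition arclength_parametrization :: "(real \<Rightarrow> complex) \<Rightarrow> real set \<Rightarrow> bool" where
  "arclength_parametrization \<gamma> I \<longleftrightarrow>
     open I \<and> is_interval I \<and> inj_on \<gamma> I \<and>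
     (\<forall>s\<in>I. \<exists>v. (\<gamma> has_vector_derivative v) (at s) \<and> norm v = 1)"

definition arclength_measure :: "(real \<Rightarrow> complex) \<Rightarrow> real set \<Rightarrow> complex measure" where
  "arclength_measure \<gamma> I = distr (restrict_space lborel I) borel \<gamma>"

(* \<rho> is the density of the exit position from U with respect to arclength, on the boundary
   arc \<gamma> ` I.  A density is determined only up to null sets, so its value at a point refers to
   the continuous version; requiring continuity makes \<rho> unique on the arc. *)
definition exit_density ::
  "'w measure \<Rightarrow> (real \<Rightarrow> 'w \<Rightarrow> complex) \<Rightarrow> complex set \<Rightarrow> (real \<Rightarrow> complex) \<Rightarrow> real set \<Rightarrow>
     (complex \<Rightarrow> real) \<Rightarrow> bool" where
  "exit_density M B U \<gamma> I \<rho> \<longleftrightarrow>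
     arclength_parametrization \<gamma> I \<and> \<gamma> ` I \<subseteq> frontier U \<and>
     continuous_on (\<gamma> ` I) \<rho> \<and> (\<forall>z\<in>\<gamma> ` I. 0 \<le> \<rho> z) \<and>
     (\<forall>E\<in>sets borel. E \<subseteq> \<gamma> ` I \<longrightarrow>
        {\<omega> \<in> space M. exit_time B U \<omega> < \<infinity> \<and> exit_point B U \<omega> \<in> E} \<in> sets M \<and>
        emeasure M {\<omega> \<in> space M. exit_time B U \<omega> < \<infinity> \<and> exit_point B U \<omega> \<in> E} =
          (\<integral>\<^sup>+z\<in>E. ennreal (\<rho> z) \<partial>arclength_measure \<gamma> I))"

definition half_strip :: "complex set" where
  "half_strip = {z. -1 < Re z \<and> Re z < 1 \<and> 0 < Im z}"

end

theory Submission
  imports Defs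
begin

text \<open>
  Let \<open>a = \<alpha> + i\<beta>\<close> be the starting point, \<open>T\<close> the exit time from the half-strip, and
  \<open>\<theta> = \<pi>(x + 1)/2\<close> the angle of a point \<open>x\<close> of the base. For each \<open>k \<ge> 1\<close> the function
  \<open>u(x + iy) = exp (-k\<pi>y/2) sin (k\<theta>)\<close> is harmonic, bounded on the half-strip, zero on its vertical
  sides, and equal to \<open>sin (k\<theta>)\<close> on its base. Optional stopping therefore yields the sine moments
  of the exit law on the base:
  \<open>E[sin (k\<theta>(B\<^sub>T)); B\<^sub>T on the base] = u(a)\<close>. A finite measure on the base is determined by these
  moments, so it remains to exhibit a density that has them, namely
  \<open>\<Sum>k. exp (-k\<pi>\<beta>/2) sin (k\<theta>(\<alpha>)) sin (k\<theta>(x))\<close>.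

  \<^item> Summed as a geometric series, this is the closed form (\<open>half_strip_kernel_sine_series\<close>,
    \<open>half_strip_kernel_sine_moments\<close>). The reflected series has the same sum by the partial
    fractions of the cotangent, which follow from the reflection formula of the Gamma function
    (\<open>has_sum_reflected_cauchy_kernel\<close>).
  \<^item> Optional stopping is elementary, since \<open>u\<close> is the imaginary part of the exponential
    \<open>exp (ik\<pi>(z + 1)/2)\<close> and an exponential of an increment factors off. The exit time is approximated
    from above on a grid, the stopped exponential is written as a telescoping sum
    (\<open>expectation_stopped\<close>), and a second-moment bound allows the mesh to tend to 0
    (\<open>expectation_exp_stopped\<close>). The independence that this needs, of an increment and the event
    that the path has not yet left the domain, is a limit of statements about finitely many
    increments (\<open>expectation_survival_times_increment\<close>). The exit time is finite because the real
    part alone leaves a bounded interval (\<open>AE_exit_time_finite\<close>).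
  \<^item> Uniqueness (\<open>sine_moments_determine_measure\<close>) reduces to the moment problem on \<open>[-1, 1]\<close>
    through the substitution \<open>cos \<theta>\<close>, and that to the uniqueness of characteristic functions.
\<close>

section \<open>The reflected series in closed form\<close>

lemma Im_cot_complex:
  fixes z :: complex
  assumes "0 < Im z"
  shows "Im (cot z) = - sinh (2 * Im z) / (cosh (2 * Im z) - cos (2 * Re z))"
proof -
  define p q where "p = Re z" and "q = Im z"
  have q: "q > 0" using assms by (simp add: q_def)
  have s: "Re (sin z) = sin p * cosh q" "Im (sin z) = cos p * sinh q"
    "Re (cos z) = cos p * cosh q" "Im (cos z) = - sin p * sinh q"
    by (simp_all add: Re_sin Im_sin Re_cos Im_cos cosh_def sinh_def p_def q_def field_simps)
  have sq: "(sin p)\<^sup>2 = 1 - (cos p)\<^sup>2" "(cosh q)\<^sup>2 = 1 + (sinh q)\<^sup>2"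
    by (simp_all add: sin_squared_eq cosh_square_eq)
  have den: "(Re (sin z))\<^sup>2 + (Im (sin z))\<^sup>2 = (sinh q)\<^sup>2 + (sin p)\<^sup>2"
    unfolding s power_mult_distrib sq by (simp add: algebra_simps)
  have num: "Im (cos z) * Re (sin z) - Re (cos z) * Im (sin z) = - (sinh q * cosh q)"
  proof -
    have "Im (cos z) * Re (sin z) - Re (cos z) * Im (sin z) 
      = - (sinh q * cosh q) * ((sin p)\<^sup>2 + (cos p)\<^sup>2)"
      unfolding s by algebra
    then show ?thesis by (simp only: sin_cos_squared_add mult_1_right)
  qed
  have d2: "cosh (2 * q) - cos (2 * p) = 2 * ((sinh q)\<^sup>2 + (sin p)\<^sup>2)"
    unfolding cosh_double cos_double sq by simp
  have "(sinh q)\<^sup>2 > 0" using q by simp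
  then have pos: "(sinh q)\<^sup>2 + (sin p)\<^sup>2 > 0" by (simp add: add_pos_nonneg)
  have "Im (cot z) = - (sinh q * cosh q) / ((sinh q)\<^sup>2 + (sin p)\<^sup>2)"
    unfolding cot_def Im_divide den num ..
  also have "\<dots> = - sinh (2 * q) / (cosh (2 * q) - cos (2 * p))"
    unfolding d2 sinh_double mult.assoc by (simp only: mult_minus_right[symmetric] mult_divide_mult_cancel_left_if) simp
  finally show ?thesis by (simp add: p_def q_def)
qed

lemma not_Ints_imp_not_nonpos_Ints:
  fixes z :: complex
  assumes "z \<notin> \<int>"
  shows "z \<notin> \<int>\<^sub>\<le>\<^sub>0" "1 - z \<notin> \<int>\<^sub>\<le>\<^sub>0"
proof -
  show "z \<notin> \<int>\<^sub>\<le>\<^sub>0" using assms nonpos_Ints_Int by blast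
  show "1 - z \<notin> \<int>\<^sub>\<le>\<^sub>0"
  proof
    assume "1 - z \<in> \<int>\<^sub>\<le>\<^sub>0"
    then have "1 - z \<in> \<int>" by (rule nonpos_Ints_Int)
    then have "1 - (1 - z) \<in> \<int>" by (rule Ints_diff[OF Ints_1])
    then show False using assms by simp
  qed
qed

text \<open>The logarithmic derivative of Euler's reflection formula
  \<open>\<Gamma>(z) \<Gamma>(1 - z) = \<pi> / sin(\<pi> z)\<close>. Together with the series of the digamma function it
  gives the partial fractions of the cotangent.\<close>

lemma Digamma_reflection:
  fixes z :: complex
  assumes z: "z \<notin> \<int>"
  shows "Digamma (1 - z) - Digamma z = of_real pi * cot (of_real pi * z)"
proof -
  note nz = not_Ints_imp_not_nonpos_Ints[OF z]
  have s: "sin (of_real pi * z) \<noteq> 0"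
    using z by (subst sin_eq_0) (auto simp: field_simps)
  have d1: "((\<lambda>w. Gamma w * Gamma (1 - w)) has_field_derivative
      (Gamma z * Gamma (1 - z) * (Digamma z - Digamma (1 - z)))) (at z)"
    using nz by (auto intro!: derivative_eq_intros simp: algebra_simps)
  have d2: "((\<lambda>w. of_real pi / sin (of_real pi * w)) has_field_derivative
      (- of_real pi * (of_real pi * cos (of_real pi * z)) / (sin (of_real pi * z))\<^sup>2)) (at z)"
    using s by (auto intro!: derivative_eq_intros simp: power2_eq_square)
  have "(\<lambda>w::complex. Gamma w * Gamma (1 - w)) = (\<lambda>w. of_real pi / sin (of_real pi * w))"
    by (rule ext) (rule Gamma_reflection_complex)
  with d1 d2 have "Gamma z * Gamma (1 - z) * (Digamma z - Digamma (1 - z)) =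
      - of_real pi * (of_real pi * cos (of_real pi * z)) / (sin (of_real pi * z))\<^sup>2"
    using DERIV_unique by metis
  then have "of_real pi / sin (of_real pi * z) * (Digamma z - Digamma (1 - z)) =
      - of_real pi * (of_real pi * cos (of_real pi * z)) / (sin (of_real pi * z))\<^sup>2"
    by (simp add: Gamma_reflection_complex)
  then have "(Digamma (1 - z) - Digamma z) * (of_real pi / sin (of_real pi * z)) =
      of_real pi * cot (of_real pi * z) * (of_real pi / sin (of_real pi * z))"
    by (simp add: cot_def power2_eq_square algebra_simps)
  then show ?thesis
    using s by (simp only: mult_right_cancel[of "of_real pi / sin (of_real pi * z)"] divide_eq_0_iff
      of_real_eq_0_iff pi_neq_zero simp_thms)
qed

text \<open>The imaginary part of \<open>\<pi> cot(\<pi> z) = \<Sum>1 / (z - m)\<close> at \<open>z = u + iy\<close>. The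
  digamma series pairs the terms \<open>m = -k\<close> and \<open>m = k + 1\<close>; all terms are nonnegative, so the
  pairs can be taken apart again and the sum is unconditional.\<close>

lemma has_sum_int_cauchy_kernel:
  fixes u y :: real
  assumes y: "0 < y"
  shows "((\<lambda>m::int. y / ((u - real_of_int m)\<^sup>2 + y\<^sup>2)) has_sum
           pi * sinh (2 * pi * y) / (cosh (2 * pi * y) - cos (2 * pi * u))) UNIV"
proof -
  define f where "f m = y / ((u - real_of_int m)\<^sup>2 + y\<^sup>2)" for m :: int
  define S where "S = pi * sinh (2 * pi * y) / (cosh (2 * pi * y) - cos (2 * pi * u))"
  define z where "z = Complex u y"
  have zI: "z \<notin> \<int>" using y by (auto simp: z_def elim!: Ints_cases simp: complex_eq_iff)
  note zn = not_Ints_imp_not_nonpos_Ints[OF zI]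
  have sm: "(\<lambda>k. inverse (of_nat (Suc k)) - inverse (w + of_nat k)) sums (Digamma w + euler_mascheroni)"
    if "w \<notin> \<int>\<^sub>\<le>\<^sub>0" for w :: complex
  proof -
    have "w \<noteq> 0" using that by auto
    from summable_Digamma[OF this] show ?thesis
      by (simp add: Digamma_def summable_sums)
  qed
  have "(\<lambda>k. inverse (z + of_nat k) - inverse (1 - z + of_nat k)) sums (Digamma (1 - z) - Digamma z)"
    using sums_diff[OF sm[OF zn(2)] sm[OF zn(1)]] by simp
  then have "(\<lambda>k. Im (inverse (z + of_nat k) - inverse (1 - z + of_nat k))) sums
      Im (of_real pi * cot (of_real pi * z))"
    unfolding Digamma_reflection[OF zI] by (rule sums_Im)
  moreover have "Im (inverse (z + of_nat k) - inverse (1 - z + of_nat k)) =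
      - (f (- int k) + f (int k + 1))" for k
  proof -
    have "(1 - u + real k)\<^sup>2 = (u - (real k + 1))\<^sup>2" by (simp add: power2_eq_square algebra_simps)
    then have "Im (inverse (1 - z + of_nat k)) = f (int k + 1)"
      by (simp add: z_def f_def)
    moreover have "Im (inverse (z + of_nat k)) = - f (- int k)"
      by (simp add: z_def f_def)
    ultimately show ?thesis by simp
  qed
  moreover have "Im (of_real pi * cot (of_real pi * z)) = - S"
    using Im_cot_complex[of "of_real pi * z"] y by (simp add: z_def S_def mult.assoc)
  ultimately have "(\<lambda>k. - (f (- int k) + f (int k + 1))) sums (- S)"
    by simp
  from sums_minus[OF this] have sS: "(\<lambda>k. f (- int k) + f (int k + 1)) sums S"
    by (simp only: minus_minus)
  have fpos: "f m \<ge> 0" for m using y by (simp add: f_def)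
  have sm2: "summable (\<lambda>k. f (- int k))" "summable (\<lambda>k. f (int k + 1))"
    and S: "S = (\<Sum>k. f (- int k)) + (\<Sum>k. f (int k + 1))"
  proof -
    show 1: "summable (\<lambda>k. f (- int k))" "summable (\<lambda>k. f (int k + 1))"
      by (rule summable_comparison_test'[OF sums_summable[OF sS], of 0], simp add: fpos)+
    show "S = (\<Sum>k. f (- int k)) + (\<Sum>k. f (int k + 1))"
      using sums_add[OF summable_sums[OF 1(1)] summable_sums[OF 1(2)]] sS by (rule sums_unique2[rotated])
  qed
  have h1: "((\<lambda>k. f (- int k)) has_sum (\<Sum>k. f (- int k))) UNIV"
    "((\<lambda>k. f (int k + 1)) has_sum (\<Sum>k. f (int k + 1))) UNIV"
    using sm2 fpos by (auto intro!: sums_nonneg_imp_has_sum summable_sums)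
  have "(f has_sum (\<Sum>k. f (- int k))) (range (\<lambda>k. - int k))"
    using h1(1) by (subst has_sum_reindex) (auto simp: inj_on_def o_def)
  moreover have "(f has_sum (\<Sum>k. f (int k + 1))) (range (\<lambda>k. int k + 1))"
    using h1(2) by (subst has_sum_reindex) (auto simp: inj_on_def o_def)
  ultimately have "(f has_sum S) (range (\<lambda>k. - int k) \<union> range (\<lambda>k. int k + 1))"
    unfolding S by (rule has_sum_Un_disjoint) auto
  moreover have "range (\<lambda>k. - int k) \<union> range (\<lambda>k. int k + 1) = UNIV"
  proof -
    have "m \<in> range (\<lambda>k. - int k) \<union> range (\<lambda>k. int k + 1)" for m :: int
    proof (cases "m \<le> 0")
      case True
      then have "m = - int (nat (- m))" by simp
      then show ?thesis by blast
    next
      case False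
      then have "m = int (nat (m - 1)) + 1" by simp
      then show ?thesis by blast
    qed
    then show ?thesis by blast
  qed
  ultimately show ?thesis by (simp add: f_def[abs_def] S_def)
qed

definition half_strip_kernel :: "real \<Rightarrow> real \<Rightarrow> real \<Rightarrow> real" where
  "half_strip_kernel \<alpha> \<beta> x =
    1 / 2 * (sinh (pi * \<beta> / 2) * cos (pi * \<alpha> / 2) * cos (pi * x / 2) /
          ((sinh (pi * \<beta> / 2))^2 + (sin (pi * \<alpha> / 2))^2 + (sin (pi * x / 2))^2
            - 2 * cosh (pi * \<beta> / 2) * sin (pi * \<alpha> / 2) * sin (pi * x / 2)))"

text \<open>The identity behind the split of the kernel into two Poisson
  kernels, one for each of the two classes of reflected points.\<close>

lemma kernel_denominator_factorization:
  fixes A X b :: real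
  shows "(sinh b)\<^sup>2 + (sin A)\<^sup>2 + (sin X)\<^sup>2 - 2 * cosh b * sin A * sin X =
    (cosh b - cos (A - X)) * (cosh b + cos (A + X))"
proof -
  have s: "(sinh b)\<^sup>2 = (cosh b)\<^sup>2 - 1" by (simp add: cosh_square_eq)
  have "(cos A * cos X)\<^sup>2 = (1 - (sin A)\<^sup>2) * (1 - (sin X)\<^sup>2)"
    unfolding power_mult_distrib by (simp add: cos_squared_eq)
  moreover have "(cosh b - cos (A - X)) * (cosh b + cos (A + X)) =
     (cosh b - sin A * sin X)\<^sup>2 - (cos A * cos X)\<^sup>2"
    unfolding cos_add cos_diff by (simp add: power2_eq_square algebra_simps)
  ultimately show ?thesis
    unfolding s by (simp add: power2_eq_square algebra_simps)
qed

lemma cos_less_cosh: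
  fixes b t :: real
  assumes "b \<noteq> 0"
  shows "cos t < cosh b"
proof -
  have "1 < cosh b" using assms by (metis cosh_real_ge_1 cosh_real_one_iff order_less_le)
  then show ?thesis using cos_le_one[of t] by linarith
qed

lemma half_strip_kernel_split:
  assumes "0 < \<beta>"
  shows "half_strip_kernel \<alpha> \<beta> x = 1 / 4 *
     (sinh (pi * \<beta> / 2) / (cosh (pi * \<beta> / 2) - cos (pi * \<alpha> / 2 - pi * x / 2)) -
      sinh (pi * \<beta> / 2) / (cosh (pi * \<beta> / 2) + cos (pi * \<alpha> / 2 + pi * x / 2)))"
proof -
  define b A X where "b = pi * \<beta> / 2" and "A = pi * \<alpha> / 2" and "X = pi * x / 2"
  have b: "b \<noteq> 0" using assms by (simp add: b_def)
  have pos: "cosh b - cos (A - X) > 0" "cosh b + cos (A + X) > 0"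
    using cos_less_cosh[OF b, of "A - X"] cos_less_cosh[OF b, of "A + X + pi"] by auto
  have n: "cos (A + X) + cos (A - X) = 2 * cos A * cos X"
    by (simp add: cos_add cos_diff)
  have "sinh b / (cosh b - cos (A - X)) - sinh b / (cosh b + cos (A + X)) =
     sinh b * (cos (A + X) + cos (A - X)) / ((cosh b - cos (A - X)) * (cosh b + cos (A + X)))"
    using pos by (simp add: field_simps)
  then show ?thesis
    unfolding half_strip_kernel_def b_def[symmetric] A_def[symmetric] X_def[symmetric]
      kernel_denominator_factorization n by (simp add: algebra_simps)
qed

text \<open>The even indices translate the point \<open>x\<close> by multiples of 4, the
  odd ones translate its mirror image \<open>2 - x\<close>. Each class is a sum of Cauchy kernels over a
  lattice.\<close>

lemma has_sum_reflected_cauchy_kernel: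
  assumes \<beta>: "0 < \<beta>"
  shows "((\<lambda>n::int. (-1) powi n * (\<beta> / (\<beta>^2 + (\<alpha> - (2 * real_of_int n + (-1) powi n * x))^2)))
     has_sum (pi * half_strip_kernel \<alpha> \<beta> x)) UNIV"
proof -
  define f where "f n = (-1) powi n * (\<beta> / (\<beta>^2 + (\<alpha> - (2 * real_of_int n + (-1) powi n * x))^2))"
    for n :: int
  define b where "b = pi * \<beta> / 2"
  have scale: "\<beta> / (\<beta>^2 + v^2) = 1 / 4 * ((\<beta> / 4) / ((v / 4)^2 + (\<beta> / 4)^2))" for v
  proof -
    have "(v / 4)^2 + (\<beta> / 4)^2 = (\<beta>^2 + v^2) / 16" by (simp add: field_simps power2_eq_square)
    then show ?thesis by simp
  qed
  have ev: "f (2 * m) = 1 / 4 * ((\<beta> / 4) / (((\<alpha> - x) / 4 - real_of_int m)\<^sup>2 + (\<beta> / 4)\<^sup>2))" for m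
  proof -
    have "f (2 * m) = \<beta> / (\<beta>^2 + (\<alpha> - (4 * real_of_int m + x))^2)"
      by (simp add: f_def power_int_mult)
    moreover have "(\<alpha> - (4 * real_of_int m + x)) / 4 = (\<alpha> - x) / 4 - real_of_int m"
      by (simp add: field_simps)
    ultimately show ?thesis by (simp only: scale)
  qed
  have od: "f (2 * m + 1) = - 1 / 4 * ((\<beta> / 4) / (((\<alpha> + x - 2) / 4 - real_of_int m)\<^sup>2 + (\<beta> / 4)\<^sup>2))" for m
  proof -
    have "f (2 * m + 1) = - (\<beta> / (\<beta>^2 + (\<alpha> - (4 * real_of_int m + 2 - x))^2))"
      by (simp add: f_def power_int_mult power_int_add)
    moreover have "(\<alpha> - (4 * real_of_int m + 2 - x)) / 4 = (\<alpha> + x - 2) / 4 - real_of_int m"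
      by (simp add: field_simps)
    ultimately show ?thesis by (simp only: scale)
  qed
  have "((\<lambda>m. f (2 * m)) has_sum
      1 / 4 * (pi * sinh (2 * pi * (\<beta> / 4)) / (cosh (2 * pi * (\<beta> / 4)) - cos (2 * pi * ((\<alpha> - x) / 4))))) UNIV"
    unfolding ev using \<beta> by (intro has_sum_cmult_right has_sum_int_cauchy_kernel) simp
  then have 1: "(f has_sum
      1 / 4 * (pi * sinh (2 * pi * (\<beta> / 4)) / (cosh (2 * pi * (\<beta> / 4)) - cos (2 * pi * ((\<alpha> - x) / 4)))))
      (range (\<lambda>m. 2 * m))"
    by (subst has_sum_reindex) (auto simp: inj_on_def o_def)
  have "((\<lambda>m. f (2 * m + 1)) has_sum
     - 1 / 4 * (pi * sinh (2 * pi * (\<beta> / 4)) / (cosh (2 * pi * (\<beta> / 4)) - cos (2 * pi * ((\<alpha> + x - 2) / 4))))) UNIV"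
    unfolding od using \<beta> by (intro has_sum_cmult_right has_sum_int_cauchy_kernel) simp
  then have 2: "(f has_sum
      - 1 / 4 * (pi * sinh (2 * pi * (\<beta> / 4)) / (cosh (2 * pi * (\<beta> / 4)) - cos (2 * pi * ((\<alpha> + x - 2) / 4)))))
      (range (\<lambda>m. 2 * m + 1))"
    by (subst has_sum_reindex) (auto simp: inj_on_def o_def)
  have dis: "range (\<lambda>m::int. 2 * m) \<inter> range (\<lambda>m. 2 * m + 1) = {}" by auto presburger
  have un: "range (\<lambda>m::int. 2 * m) \<union> range (\<lambda>m. 2 * m + 1) = UNIV"
  proof -
    have "n \<in> range (\<lambda>m::int. 2 * m) \<union> range (\<lambda>m. 2 * m + 1)" for n
      by (cases "even n") (auto elim!: evenE oddE)
    then show ?thesis by blast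
  qed
  have c1: "cos (2 * pi * ((\<alpha> - x) / 4)) = cos (pi * \<alpha> / 2 - pi * x / 2)"
    by (rule arg_cong[where f=cos]) (simp add: field_simps)
  have "2 * pi * ((\<alpha> + x - 2) / 4) = pi * \<alpha> / 2 + pi * x / 2 - pi" by (simp add: field_simps)
  then have c2: "cos (2 * pi * ((\<alpha> + x - 2) / 4)) = - cos (pi * \<alpha> / 2 + pi * x / 2)"
    by (simp only: cos_minus_pi)
  have c3: "2 * pi * (\<beta> / 4) = pi * \<beta> / 2" by simp
  show ?thesis
    using has_sum_Un_disjoint[OF 1 2 dis]
    unfolding un c1 c2 c3 half_strip_kernel_split[OF \<beta>] f_def[symmetric]
    by (simp add: algebra_simps)
qed

section \<open>The sine expansion of the kernel\<close>

text \<open>The real part of the geometric series in \<open>exp (-b + i\<phi>)\<close>: the quotient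
  on the right is the Poisson kernel of the disc.\<close>

lemma sums_exp_cos:
  fixes b \<phi> :: real
  assumes "0 < b"
  shows "(\<lambda>k. exp (- b * real k) * cos (real k * \<phi>)) sums (1 / 2 + 1 / 2 * (sinh b / (cosh b - cos \<phi>)))"
proof -
  define z where "z = complex_of_real (exp (- b)) * cis \<phi>"
  have nz: "norm z < 1" using assms by (simp add: z_def norm_mult)
  have "(\<lambda>k. Re (z ^ k)) sums Re (1 / (1 - z))"
    by (intro sums_Re geometric_sums nz)
  moreover have "Re (z ^ k) = exp (- b * real k) * cos (real k * \<phi>)" for k
  proof -
    have "z ^ k = complex_of_real (exp (- b) ^ k) * cis (real k * \<phi>)"
      by (simp add: z_def power_mult_distrib Complex.DeMoivre)
    moreover have "exp (- b) ^ k = exp (- b * real k)"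
      by (simp add: exp_of_nat_mult[symmetric] mult.commute)
    ultimately show ?thesis by simp
  qed
  moreover have "Re (1 / (1 - z)) = 1 / 2 + 1 / 2 * (sinh b / (cosh b - cos \<phi>))"
  proof -
    define r where "r = exp (- b)"
    have r: "0 < r" "r < 1" using assms by (auto simp: r_def)
    have ch: "cosh b = (1 / r + r) / 2" "sinh b = (1 / r - r) / 2"
      by (simp_all add: cosh_def sinh_def r_def exp_minus field_simps)
    have den: "cosh b - cos \<phi> = (1 - 2 * r * cos \<phi> + r\<^sup>2) / (2 * r)"
      unfolding ch using r by (simp add: field_simps power2_eq_square)
    have num: "sinh b = (1 - r\<^sup>2) / (2 * r)"
      unfolding ch using r by (simp add: field_simps power2_eq_square)
    have pos: "1 - 2 * r * cos \<phi> + r\<^sup>2 > 0"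
    proof -
      have "cosh b - cos \<phi> > 0" using cos_less_cosh[of b \<phi>] assms by simp
      then show ?thesis unfolding den using r by (simp add: zero_less_divide_iff)
    qed
    have R: "Re (1 - z) = 1 - r * cos \<phi>" "Im (1 - z) = - r * sin \<phi>"
      by (simp_all add: z_def r_def)
    have "(1 - r * cos \<phi>)\<^sup>2 + (- r * sin \<phi>)\<^sup>2 = 1 - 2 * r * cos \<phi> + r\<^sup>2 * ((sin \<phi>)\<^sup>2 + (cos \<phi>)\<^sup>2)"
      by algebra
    then have "Re (1 / (1 - z)) = (1 - r * cos \<phi>) / (1 - 2 * r * cos \<phi> + r\<^sup>2)"
      unfolding Re_divide R by simp
    also have "\<dots> = 1 / 2 + 1 / 2 * (sinh b / (cosh b - cos \<phi>))"
    proof -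
      define d where "d = 1 - 2 * r * cos \<phi> + r\<^sup>2"
      have d: "d > 0" "2 * (1 - r * cos \<phi>) = d + (1 - r\<^sup>2)" using pos by (simp_all add: d_def)
      have "sinh b / (cosh b - cos \<phi>) = (1 - r\<^sup>2) / d"
        unfolding num den d_def using r by simp
      moreover have "(1 - r * cos \<phi>) / d = 1 / 2 + 1 / 2 * ((1 - r\<^sup>2) / d)"
      proof -
        have "1 - r * cos \<phi> = d * (1 / 2) + 1 / 2 * (1 - r\<^sup>2)" using d(2) by (simp add: algebra_simps)
        then show ?thesis using d(1) by (simp only: add_divide_distrib) simp
      qed
      ultimately show ?thesis unfolding d_def[symmetric] by (simp only:)
    qed
    finally show ?thesis .
  qed
  ultimately show ?thesis by simp
qed

definition strip_angle :: "real \<Rightarrow> real" where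
  "strip_angle x = pi * (x + 1) / 2"

text \<open>Separation of variables: the Dirichlet eigenfunctions of the
  segment are \<open>sin (k \<theta>)\<close> with \<open>\<theta> = strip_angle x\<close>, and the \<open>k\<close>-th one decays like
  \<open>exp (-k\<pi>y/2)\<close> into the half-strip. A product of sines is a difference of cosines, which turns
  the series into two Poisson series.\<close>

lemma half_strip_kernel_sine_series:
  assumes "0 < \<beta>"
  shows "(\<lambda>k. exp (- (pi * \<beta> / 2) * real k) *
      (sin (real k * strip_angle \<alpha>) * sin (real k * strip_angle x))) sums half_strip_kernel \<alpha> \<beta> x"
proof -
  have b: "pi * \<beta> / 2 > 0" using assms by simp
  define P where "P \<phi> = 1 / 2 + 1 / 2 * (sinh (pi * \<beta> / 2) / (cosh (pi * \<beta> / 2) - cos \<phi>))" for \<phi>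
  have *: "sin (real k * s) * sin (real k * t) = 1 / 2 * (cos (real k * (s - t)) - cos (real k * (s + t)))" for s t k
    by (simp add: right_diff_distrib distrib_left cos_add cos_diff)
  have "(\<lambda>k. 1 / 2 * (exp (- (pi * \<beta> / 2) * real k) * cos (real k * (strip_angle \<alpha> - strip_angle x)) -
      exp (- (pi * \<beta> / 2) * real k) * cos (real k * (strip_angle \<alpha> + strip_angle x)))) sums
      (1 / 2 * (P (strip_angle \<alpha> - strip_angle x) - P (strip_angle \<alpha> + strip_angle x)))"
    unfolding P_def by (intro sums_mult sums_diff sums_exp_cos b)
  moreover have "cos (strip_angle \<alpha> - strip_angle x) = cos (pi * \<alpha> / 2 - pi * x / 2)"
    by (rule arg_cong[where f=cos]) (simp add: strip_angle_def field_simps)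
  moreover have "cos (strip_angle \<alpha> + strip_angle x) = - cos (pi * \<alpha> / 2 + pi * x / 2)"
  proof -
    have "strip_angle \<alpha> + strip_angle x = pi * \<alpha> / 2 + pi * x / 2 + pi"
      by (simp add: strip_angle_def field_simps)
    then show ?thesis by simp
  qed
  ultimately show ?thesis
    unfolding half_strip_kernel_split[OF assms] * P_def by (simp add: algebra_simps)
qed

lemma sine_orthogonality:
  fixes j k :: nat
  assumes "0 < k"
  shows "has_bochner_integral lborel
    (\<lambda>x. sin (real j * strip_angle x) * sin (real k * strip_angle x) * indicator {-1..1} x)
    (if j = k then 1 else 0)"
proof -
  \<comment> \<open>an antiderivative of \<open>cos (m \<theta>)\<close>\<close>
  define F where "F m x = (if m = 0 then x else 2 / (pi * real_of_int m) * sin (real_of_int m * strip_angle x))"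
    for m :: int and x
  have F': "DERIV (F m) x :> cos (real_of_int m * strip_angle x)" for m x
    unfolding F_def strip_angle_def
    by (cases "m = 0") (auto intro!: derivative_eq_intros simp: field_simps)
  have F1: "F m 1 - F m (-1) = (if m = 0 then 2 else 0)" for m
  proof -
    have "sin (real_of_int m * pi) = 0" by (subst mult.commute) (rule sin_npi_int)
    then show ?thesis by (simp add: F_def strip_angle_def)
  qed
  have "has_bochner_integral lborel
      (\<lambda>x. cos (real_of_int m * strip_angle x) * indicator {-1..1} x) (if m = 0 then 2 else 0)" for m
    using has_bochner_integral_FTC_Icc_real[of "-1" 1 "F m" "\<lambda>x. cos (real_of_int m * strip_angle x)"] F'
    unfolding F1 by (auto intro!: continuous_intros simp: strip_angle_def)
  note c = this
  have "has_bochner_integral lborel (\<lambda>x. 1 / 2 *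
      (cos (real_of_int (int j - int k) * strip_angle x) * indicator {-1..1} x -
       cos (real_of_int (int j + int k) * strip_angle x) * indicator {-1..1} x))
      (1 / 2 * ((if int j - int k = 0 then 2 else 0) - (if int j + int k = 0 then 2 else 0)))"
    by (intro has_bochner_integral_mult_right has_bochner_integral_diff c)
  moreover have "1 / 2 * ((if int j - int k = 0 then 2 else 0) - (if int j + int k = 0 then 2 else 0)) =
      (if j = k then 1 else (0::real))" using assms by simp
  moreover have "1 / 2 *
      (cos (real_of_int (int j - int k) * strip_angle x) * indicator {-1..1} x -
       cos (real_of_int (int j + int k) * strip_angle x) * indicator {-1..1} x) =
      sin (real j * strip_angle x) * sin (real k * strip_angle x) * indicator {-1..1} x" for x :: real
    by (simp add: left_diff_distrib distrib_right cos_add cos_diff)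
  ultimately show ?thesis by simp
qed

lemma continuous_half_strip_kernel:
  assumes "0 < \<beta>"
  shows "continuous_on UNIV (half_strip_kernel \<alpha> \<beta>)"
proof -
  have b: "pi * \<beta> / 2 \<noteq> 0" using assms by simp
  have "cosh (pi * \<beta> / 2) + cos t > 0" for t
    using cos_less_cosh[OF b, of "t + pi"] by simp
  moreover have "cosh (pi * \<beta> / 2) - cos t > 0" for t
    using cos_less_cosh[OF b, of t] by simp
  ultimately have "continuous_on UNIV (\<lambda>x. 1 / 4 *
     (sinh (pi * \<beta> / 2) / (cosh (pi * \<beta> / 2) - cos (pi * \<alpha> / 2 - pi * x / 2)) -
      sinh (pi * \<beta> / 2) / (cosh (pi * \<beta> / 2) + cos (pi * \<alpha> / 2 + pi * x / 2))))"
    by (auto intro!: continuous_intros simp: less_imp_neq[symmetric] dest: less_imp_neq)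
  then show ?thesis
    by (rule continuous_on_cong[THEN iffD1, rotated -1]) (auto simp: half_strip_kernel_split[OF assms])
qed

lemma half_strip_kernel_nonneg:
  assumes "0 < \<beta>" "\<bar>\<alpha>\<bar> \<le> 1" "\<bar>x\<bar> \<le> 1"
  shows "0 \<le> half_strip_kernel \<alpha> \<beta> x"
proof -
  have b: "pi * \<beta> / 2 \<noteq> 0" using assms by simp
  define A X where "A = pi * \<alpha> / 2" and "X = pi * x / 2"
  have "cosh (pi * \<beta> / 2) + cos (A + X) > 0" "cosh (pi * \<beta> / 2) - cos (A - X) > 0"
    using cos_less_cosh[OF b, of "A + X + pi"] cos_less_cosh[OF b, of "A - X"] by simp_all
  moreover have "cos A \<ge> 0" "cos X \<ge> 0"
  proof -
    have "cos (pi * y / 2) \<ge> 0" if "\<bar>y\<bar> \<le> 1" for y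
    proof -
      have "\<bar>pi * y / 2\<bar> \<le> pi / 2" using that by (simp add: abs_mult)
      then show ?thesis by (intro cos_ge_zero) (auto simp: abs_le_iff)
    qed
    then show "cos A \<ge> 0" "cos X \<ge> 0" unfolding A_def X_def using assms by auto
  qed
  ultimately show ?thesis
    unfolding half_strip_kernel_def A_def[symmetric] X_def[symmetric] kernel_denominator_factorization
    using assms by simp
qed

text \<open>These moments are read off the sine series; its terms are
  dominated by a geometric series, so it may be integrated term by term.\<close>

lemma half_strip_kernel_sine_moments:
  assumes "0 < \<beta>" "0 < k"
  shows "has_bochner_integral lborel
    (\<lambda>x. half_strip_kernel \<alpha> \<beta> x * sin (real k * strip_angle x) * indicator {-1..1} x)
    (exp (- (pi * \<beta> / 2) * real k) * sin (real k * strip_angle \<alpha>))"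
proof -
  define b where "b = pi * \<beta> / 2"
  have b: "b > 0" using assms by (simp add: b_def)
  define c where "c j = exp (- b * real j) * sin (real j * strip_angle \<alpha>)" for j :: nat
  define g where "g j x = sin (real j * strip_angle x) * sin (real k * strip_angle x) * indicator {-1..1} x"
    for j and x :: real
  define f where "f j x = c j * g j x" for j x
  have geo: "summable (\<lambda>j. exp (- b * real j))"
  proof -
    have "summable (\<lambda>j. exp (- b) ^ j)" using b by (intro summable_geometric) simp
    then show ?thesis by (simp add: exp_of_nat_mult[symmetric] mult.commute)
  qed
  have cb: "\<bar>c j\<bar> \<le> exp (- b * real j)" for j
    unfolding c_def abs_mult by (simp add: mult_left_le)
  have gb: "\<bar>g j x\<bar> \<le> indicator {-1..1} x" for j x
    unfolding g_def abs_mult by (auto simp: indicator_def intro!: mult_le_one)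
  have g: "has_bochner_integral lborel (g j) (if j = k then 1 else 0)" for j
    unfolding g_def[abs_def] using assms(2) by (rule sine_orthogonality)
  have fint: "has_bochner_integral lborel (f j) (c j * (if j = k then 1 else 0))" for j
    unfolding f_def[abs_def] by (intro has_bochner_integral_mult_right g)
  have ind: "integrable lborel (indicator {-1..1::real} :: real \<Rightarrow> real)"
    by (simp add: integrable_indicator_iff)
  have sumf: "summable (\<lambda>j. norm (f j x))" for x
  proof (rule summable_comparison_test'[OF geo, of 0])
    fix j
    have "\<bar>c j\<bar> * \<bar>g j x\<bar> \<le> exp (- b * real j) * 1"
      using gb[of j x] by (intro mult_mono cb) (auto simp: indicator_def split: if_splits intro: order_trans)
    then show "norm (norm (f j x)) \<le> exp (- b * real j)" by (simp add: f_def abs_mult)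
  qed
  have sumi: "summable (\<lambda>j. \<integral>x. norm (f j x) \<partial>lborel)"
  proof (rule summable_comparison_test'[OF summable_mult2[OF geo, of 2], of 0])
    fix j
    have "(\<integral>x. norm (f j x) \<partial>lborel) \<le> (\<integral>x. exp (- b * real j) * indicator {-1..1::real} x \<partial>lborel)"
    proof (rule Bochner_Integration.integral_mono)
      show "integrable lborel (\<lambda>x. norm (f j x))"
        using fint by (intro integrable_norm) (simp add: has_bochner_integral_iff)
      show "integrable lborel (\<lambda>x. exp (- b * real j) * indicator {-1..1::real} x)"
        using ind by simp
      show "norm (f j x) \<le> exp (- b * real j) * indicator {-1..1} x" for x
        unfolding f_def real_norm_def abs_mult by (intro mult_mono cb gb) auto
    qed
    then show "norm (\<integral>x. norm (f j x) \<partial>lborel) \<le> exp (- b * real j) * 2"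
      by simp
  qed
  have i: "integrable lborel (f j)" for j using fint by (simp add: has_bochner_integral_iff)
  have S: "(\<Sum>j. f j x) = half_strip_kernel \<alpha> \<beta> x * sin (real k * strip_angle x) * indicator {-1..1} x" for x
  proof -
    have "(\<lambda>j. exp (- b * real j) * (sin (real j * strip_angle \<alpha>) * sin (real j * strip_angle x)) *
       (sin (real k * strip_angle x) * indicator {-1..1} x)) sums
       (half_strip_kernel \<alpha> \<beta> x * (sin (real k * strip_angle x) * indicator {-1..1} x))"
      unfolding b_def using assms(1) by (intro sums_mult2 half_strip_kernel_sine_series)
    then show ?thesis
      by (intro sums_unique[symmetric]) (simp add: f_def g_def c_def mult_ac)
  qed
  have "integrable lborel (\<lambda>x. \<Sum>j. f j x)"
    using i sumf sumi by (intro integrable_suminf) auto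
  moreover have "(\<lambda>j. integral\<^sup>L lborel (f j)) sums (\<integral>x. (\<Sum>j. f j x) \<partial>lborel)"
    using i sumf sumi by (intro sums_integral) auto
  then have "(\<lambda>j. c j * (if j = k then 1 else 0)) sums (\<integral>x. (\<Sum>j. f j x) \<partial>lborel)"
    by (simp only: has_bochner_integral_integral_eq[OF fint])
  moreover have "(\<lambda>j. c j * (if j = k then 1 else 0)) sums c k"
    using sums_single[of k c] by (simp add: if_distrib cong: if_cong)
  ultimately have "has_bochner_integral lborel (\<lambda>x. \<Sum>j. f j x) (c k)"
    unfolding has_bochner_integral_iff using sums_unique2 by blast
  then show ?thesis unfolding S c_def b_def .
qed

section \<open>Measures on the segment are determined by their sine moments\<close>

text \<open>The moments up to order \<open>n\<close> determine the characteristic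
  function at \<open>t\<close> up to an error of \<open>2 \<bar>t\<bar>\<^sup>n / n!\<close>, by Taylor expansion on \<open>[-1, 1]\<close>.\<close>

lemma moments_determine_bounded_distribution:
  fixes M N :: "real measure"
  assumes M: "real_distribution M" and N: "real_distribution N"
    and bdM: "AE x in M. \<bar>x\<bar> \<le> 1" and bdN: "AE x in N. \<bar>x\<bar> \<le> 1"
    and moments: "\<And>n. (\<integral>x. x ^ n \<partial>M) = (\<integral>x. x ^ n \<partial>N)"
  shows "M = N"
proof (rule Levy_uniqueness[OF M N], rule ext)
  fix t :: real
  define p where "p n = (\<Sum>k\<le>n. (\<i> * complex_of_real t) ^ k / fact k * complex_of_real (\<integral>x. x ^ k \<partial>M))" for n
  have approx: "cmod (char K t - (\<Sum>k\<le>n. (\<i> * complex_of_real t) ^ k / fact k * complex_of_real (\<integral>x. x ^ k \<partial>K)))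
      \<le> 2 * \<bar>t\<bar> ^ n / fact n"
    if K: "real_distribution K" and bd: "AE x in K. \<bar>x\<bar> \<le> 1" for K n
  proof -
    interpret K: real_distribution K by (rule K)
    have b: "AE x in K. norm (x ^ k) \<le> 1" for k
      using bd by eventually_elim (simp add: power_abs power_le_one)
    have int: "integrable K (\<lambda>x. x ^ k)" for k
      by (rule K.integrable_const_bound[OF b]) simp
    have "K.expectation (\<lambda>x. \<bar>x\<bar> ^ n) \<le> K.expectation (\<lambda>x. 1)"
    proof (rule integral_mono_AE)
      show "integrable K (\<lambda>x. \<bar>x\<bar> ^ n)" using integrable_norm[OF int[of n]] by (simp add: power_abs)
      show "AE x in K. \<bar>x\<bar> ^ n \<le> 1" using bd by eventually_elim (simp add: power_le_one)
    qed simp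
    then have "K.expectation (\<lambda>x. \<bar>x\<bar> ^ n) \<le> 1" using K.prob_space by simp
    then have "2 * \<bar>t\<bar> ^ n / fact n * K.expectation (\<lambda>x. \<bar>x\<bar> ^ n) \<le> 2 * \<bar>t\<bar> ^ n / fact n * 1"
      by (intro mult_left_mono) auto
    from order_trans[OF K.char_approx1[OF int] this] show ?thesis by simp
  qed
  have "(\<lambda>n. 2 * (\<bar>t\<bar> ^ n / fact n)) \<longlonglongrightarrow> 2 * 0"
    using summable_LIMSEQ_zero[OF summable_exp[of "\<bar>t\<bar>"]]
    by (intro tendsto_mult tendsto_const) (simp add: field_simps)
  then have z: "(\<lambda>n. 2 * \<bar>t\<bar> ^ n / fact n) \<longlonglongrightarrow> 0" by simp
  have "(\<lambda>n. char M t - p n) \<longlonglongrightarrow> 0"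
    using approx[OF M bdM] unfolding p_def by (intro Lim_null_comparison[OF _ z] always_eventually allI) simp
  moreover have "(\<lambda>n. char N t - p n) \<longlonglongrightarrow> 0"
    using approx[OF N bdN] unfolding p_def moments by (intro Lim_null_comparison[OF _ z] always_eventually allI) simp
  ultimately have "(\<lambda>n. (char M t - p n) - (char N t - p n)) \<longlonglongrightarrow> 0 - 0"
    by (rule tendsto_diff)
  then have "(\<lambda>n::nat. char M t - char N t) \<longlonglongrightarrow> 0" by simp
  then show "char M t = char N t" by (simp add: LIMSEQ_const_iff)
qed

lemma arccos_strip_angle:
  assumes "-1 < x" "x < 1"
  shows "2 / pi * arccos (max (-1) (min 1 (cos (strip_angle x)))) - 1 = x"
    and "sin (strip_angle x) > 0"
    and "sqrt (1 - (cos (strip_angle x))\<^sup>2) = sin (strip_angle x)"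
proof -
  have r: "0 < strip_angle x" "strip_angle x < pi"
    using assms by (simp_all add: strip_angle_def)
  have "arccos (cos (strip_angle x)) = strip_angle x" using r by (intro arccos_cos) auto
  then show "2 / pi * arccos (max (-1) (min 1 (cos (strip_angle x)))) - 1 = x"
    by (simp add: min_absorb2 max_absorb2) (simp add: strip_angle_def)
  show s: "sin (strip_angle x) > 0" using r by (rule sin_gt_zero)
  show "sqrt (1 - (cos (strip_angle x))\<^sup>2) = sin (strip_angle x)"
    using s by (simp add: sin_squared_eq[symmetric])
qed

text \<open>The identity \<open>2 cos \<theta> sin (k\<theta>) = sin ((k+1)\<theta>) + sin ((k-1)\<theta>)\<close> shows
  that sine moments control all moments of \<open>cos \<theta>\<close> with weight \<open>sin \<theta>\<close>.\<close>

lemma sine_moments_cos_power: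
  fixes M N :: "real measure"
  assumes M: "finite_measure M" "sets M = sets borel" and N: "finite_measure N" "sets N = sets borel"
    and eq: "\<And>k::nat. 0 < k \<Longrightarrow> (\<integral>x. sin (real k * strip_angle x) \<partial>M) = (\<integral>x. sin (real k * strip_angle x) \<partial>N)"
  shows "(\<integral>x. cos (strip_angle x) ^ n * sin (real k * strip_angle x) \<partial>M) =
         (\<integral>x. cos (strip_angle x) ^ n * sin (real k * strip_angle x) \<partial>N)"
proof (induction n arbitrary: k)
  case 0
  then show ?case using eq[of k] by (cases "k = 0") auto
next
  case (Suc n)
  show ?case
  proof (cases k)
    case 0
    then show ?thesis by simp
  next
    case (Suc j)
    have int: "integrable K (\<lambda>x. cos (strip_angle x) ^ n * sin (real i * strip_angle x))"
      if K: "finite_measure K" "sets K = sets borel" for K i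
    proof -
      interpret K: finite_measure K by (rule K)
      have [measurable]: "(\<lambda>x. cos (strip_angle x) ^ n * sin (real i * strip_angle x)) \<in> borel_measurable K"
        unfolding measurable_cong_sets[OF K(2) refl] strip_angle_def by measurable
      show ?thesis
      proof (rule K.integrable_const_bound[of _ 1])
        show "AE x in K. norm (cos (strip_angle x) ^ n * sin (real i * strip_angle x)) \<le> 1"
          by (auto simp: abs_mult power_abs intro!: mult_le_one power_le_one)
      qed simp
    qed
    have *: "cos (strip_angle x) ^ Suc n * sin (real k * strip_angle x) =
      1 / 2 * (cos (strip_angle x) ^ n * sin (real (Suc k) * strip_angle x)
        + cos (strip_angle x) ^ n * sin (real j * strip_angle x))" for x
    proof -
      define t where "t = strip_angle x"
      have "real (Suc k) * t = real k * t + t" "real j * t = real k * t - t"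
        using Suc by (simp_all add: algebra_simps)
      then have "sin (real (Suc k) * t) + sin (real j * t) = 2 * (cos t * sin (real k * t))"
        by (simp only: sin_add sin_diff) simp
      then have "cos t ^ n * (sin (real (Suc k) * t) + sin (real j * t)) = cos t ^ n * (2 * (cos t * sin (real k * t)))"
        by simp
      then show ?thesis unfolding t_def[symmetric] by (simp add: algebra_simps)
    qed
    show ?thesis
      unfolding * integral_mult_right_zero
        Bochner_Integration.integral_add[OF int[OF M] int[OF M]]
        Bochner_Integration.integral_add[OF int[OF N] int[OF N]] Suc.IH ..
  qed
qed


text \<open>Weighting by \<open>sin \<theta> / c\<close> makes both measures probability
  measures, and their images under \<open>cos \<theta>\<close> have the same moments on \<open>[-1, 1]\<close>. Nothing is lost:
  \<open>cos \<theta>\<close> is injective on the segment and the weight is positive there, so both steps can be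
  undone.\<close>

lemma sine_moments_determine_measure:
  fixes M N :: "real measure"
  assumes M: "finite_measure M" "sets M = sets borel" "AE x in M. x \<in> {-1<..<1}"
    and N: "finite_measure N" "sets N = sets borel" "AE x in N. x \<in> {-1<..<1}"
    and eq: "\<And>k::nat. 0 < k \<Longrightarrow> (\<integral>x. sin (real k * strip_angle x) \<partial>M) = (\<integral>x. sin (real k * strip_angle x) \<partial>N)"
    and pos: "0 < (\<integral>x. sin (strip_angle x) \<partial>M)"
  shows "M = N"
proof -
  define c where "c = (\<integral>x. sin (strip_angle x) \<partial>M)"
  define w where "w x = max 0 (sin (strip_angle x) / c)" for x
  define push where "push K = distr (density K (\<lambda>x. ennreal (w x))) borel (\<lambda>x. cos (strip_angle x))"
    for K :: "real measure"
  \<comment> \<open>the inverse of \<open>cos \<circ> strip_angle\<close>, clamped so that it is continuous on the whole line\<close>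
  define \<xi> where "\<xi> y = 2 / pi * arccos (max (-1) (min 1 y)) - 1" for y
  have c: "c > 0" "c = (\<integral>x. sin (strip_angle x) \<partial>N)" using pos eq[of 1] by (simp_all add: c_def)
  have w0: "0 \<le> w x" for x by (simp add: w_def)
  have w: "w x = sin (strip_angle x) / c" "w x > 0" if "x \<in> {-1<..<1}" for x
  proof -
    have "sin (strip_angle x) / c > 0" using arccos_strip_angle(2)[of x] that c(1) by simp
    then show "w x = sin (strip_angle x) / c" "w x > 0" unfolding w_def by (simp_all only: max_absorb2 less_imp_le)
  qed
  have \<xi>[measurable]: "\<xi> \<in> borel_measurable borel"
    unfolding \<xi>_def by (intro borel_measurable_continuous_onI continuous_intros) auto
  have push_props: "real_distribution (push K)" "AE x in push K. \<bar>x\<bar> \<le> 1"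
      "(\<integral>y. y ^ n \<partial>push K) = (\<integral>x. cos (strip_angle x) ^ n * sin (real 1 * strip_angle x) \<partial>K) / c"
      "\<And>A. A \<in> sets borel \<Longrightarrow>
         (\<integral>\<^sup>+y. indicator A (\<xi> y) * ennreal (c / sqrt (1 - y\<^sup>2)) \<partial>push K) = emeasure K A"
    if K: "finite_measure K" "sets K = sets borel" "AE x in K. x \<in> {-1<..<1}"
      and cK: "c = (\<integral>x. sin (strip_angle x) \<partial>K)" for K n
  proof -
    interpret K: finite_measure K by (rule K)
    note [measurable_cong] = K(2)
    have [measurable]: "strip_angle \<in> borel_measurable K" "strip_angle \<in> borel_measurable borel"
      unfolding measurable_cong_sets[OF K(2) refl] strip_angle_def by measurable
    have [measurable]: "w \<in> borel_measurable K" unfolding w_def by measurable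
    have AEw: "AE x in K. w x = sin (strip_angle x) / c" using K(3) by eventually_elim (rule w)
    show "(\<integral>y. y ^ n \<partial>push K) = (\<integral>x. cos (strip_angle x) ^ n * sin (real 1 * strip_angle x) \<partial>K) / c"
    proof -
      have "(\<integral>y. y ^ n \<partial>push K) = (\<integral>x. w x * cos (strip_angle x) ^ n \<partial>K)"
        unfolding push_def by (subst integral_distr) (auto simp: integral_density w0)
      also have "\<dots> = (\<integral>x. cos (strip_angle x) ^ n * sin (real 1 * strip_angle x) / c \<partial>K)"
        using AEw by (intro integral_cong_AE) (auto elim!: eventually_mono)
      finally show ?thesis by simp
    qed
    have iw: "integrable K w"
    proof (rule K.integrable_const_bound)
      show "AE x in K. norm (w x) \<le> 1 / c"
      proof (rule AE_I2)
        fix x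
        have "sin (strip_angle x) / c \<le> 1 / c" using c(1) by (intro divide_right_mono) auto
        moreover have "0 \<le> 1 / c" using c(1) by simp
        ultimately show "norm (w x) \<le> 1 / c" unfolding w_def by simp
      qed
    qed simp
    have "emeasure (density K (\<lambda>x. ennreal (w x))) (space K) = (\<integral>\<^sup>+x. ennreal (w x) \<partial>K)"
      by (subst emeasure_density) (auto intro!: nn_integral_cong)
    also have "\<dots> = ennreal (\<integral>x. w x \<partial>K)" using iw w0 by (intro nn_integral_eq_integral) auto
    also have "(\<integral>x. w x \<partial>K) = (\<integral>x. sin (strip_angle x) / c \<partial>K)"
      using AEw by (intro integral_cong_AE) (auto elim!: eventually_mono)
    also have "\<dots> = 1" using cK c by simp
    finally have "prob_space (density K (\<lambda>x. ennreal (w x)))"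
      by (intro prob_spaceI) simp
    then interpret D: prob_space "density K (\<lambda>x. ennreal (w x))" .
    show "real_distribution (push K)" unfolding push_def
      by (rule D.real_distribution_distr) simp
    show "AE x in push K. \<bar>x\<bar> \<le> 1" unfolding push_def by (subst AE_distr_iff) auto
    fix A :: "real set" assume A[measurable]: "A \<in> sets borel"
    have "(\<integral>\<^sup>+y. indicator A (\<xi> y) * ennreal (c / sqrt (1 - y\<^sup>2)) \<partial>push K) =
       (\<integral>\<^sup>+x. ennreal (w x) * (indicator A (\<xi> (cos (strip_angle x))) *
          ennreal (c / sqrt (1 - (cos (strip_angle x))\<^sup>2))) \<partial>K)"
      unfolding push_def by (subst nn_integral_distr) (auto simp: nn_integral_density)
    also have "\<dots> = (\<integral>\<^sup>+x. indicator A x \<partial>K)"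
    proof (rule nn_integral_cong_AE, use K(3) in eventually_elim)
      fix x assume x: "x \<in> {-1<..<1::real}"
      then have "\<xi> (cos (strip_angle x)) = x" "sqrt (1 - (cos (strip_angle x))\<^sup>2) = sin (strip_angle x)"
        "sin (strip_angle x) > 0"
        unfolding \<xi>_def using arccos_strip_angle[of x] by auto
      moreover have "ennreal (w x) * ennreal (c / sin (strip_angle x)) = 1"
        using calculation c w[OF x] by (subst ennreal_mult[symmetric]) auto
      ultimately show "ennreal (w x) * (indicator A (\<xi> (cos (strip_angle x))) *
          ennreal (c / sqrt (1 - (cos (strip_angle x))\<^sup>2))) = indicator A x"
        by (simp add: indicator_def)
    qed
    also have "\<dots> = emeasure K A" using A K(2) by (subst nn_integral_indicator) auto
    finally show "(\<integral>\<^sup>+y. indicator A (\<xi> y) * ennreal (c / sqrt (1 - y\<^sup>2)) \<partial>push K) = emeasure K A" .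
  qed
  have "push M = push N"
  proof (rule moments_determine_bounded_distribution)
    show "(\<integral>y. y ^ n \<partial>push M) = (\<integral>y. y ^ n \<partial>push N)" for n
      using push_props(3)[OF M c_def, of n] push_props(3)[OF N c(2), of n]
        sine_moments_cos_power[OF M(1,2) N(1,2) eq, of n 1] by simp
  qed (use push_props(1,2)[OF M c_def] push_props(1,2)[OF N c(2)] in auto)
  then have "emeasure M A = emeasure N A" if "A \<in> sets borel" for A
    using push_props(4)[OF M c_def that] push_props(4)[OF N c(2) that] by simp
  then show ?thesis
    using M(2) N(2) by (intro measure_eqI) auto
qed

section \<open>Two limit lemmas for expectations\<close>

text \<open>Boundedness in \<open>L\<^sup>2\<close> gives uniform integrability: clipping at height
  \<open>R\<close> changes the expectations by at most \<open>C / R\<close>, and the clipped variables converge by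
  dominated convergence.\<close>

lemma L2_bounded_tendsto_expectation:
  fixes Y :: "nat \<Rightarrow> 'a \<Rightarrow> complex"
  assumes M: "prob_space M"
    and Y[measurable]: "\<And>n. Y n \<in> borel_measurable M" and Z[measurable]: "Z \<in> borel_measurable M"
    and lim: "AE x in M. (\<lambda>n. Y n x) \<longlonglongrightarrow> Z x"
    and L2: "\<And>n. integrable M (\<lambda>x. (norm (Y n x))\<^sup>2)" "\<And>n. (\<integral>x. (norm (Y n x))\<^sup>2 \<partial>M) \<le> C"
    and bd: "AE x in M. norm (Z x) \<le> 1"
  shows "(\<lambda>n. \<integral>x. Y n x \<partial>M) \<longlonglongrightarrow> (\<integral>x. Z x \<partial>M)"
proof -
  interpret prob_space M by (rule M)
  define clip where "clip R z = z /\<^sub>R max 1 (norm z / R)" for R :: real and z :: complex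
  have clip_m[measurable]: "clip R \<in> borel_measurable borel" for R
    unfolding clip_def by measurable
  have clip_bd: "norm (clip R z) \<le> R" if "0 < R" for R z
    using that by (auto simp: clip_def max_def field_simps)
  have clip_diff: "norm (z - clip R z) \<le> (norm z)\<^sup>2 / R" if "0 < R" for R z
  proof (cases "norm z \<le> R")
    case True
    then have "clip R z = z" using that by (simp add: clip_def max_def field_simps)
    then show ?thesis using that by simp
  next
    case False
    then have gt: "norm z / R > 1" using that by simp
    have "z - clip R z = (1 - R / norm z) *\<^sub>R z"
      using gt by (simp add: clip_def max_def scaleR_left_diff_distrib)
    moreover have "0 \<le> 1 - R / norm z" "1 - R / norm z \<le> 1" using that False by (auto simp: divide_le_eq_1)
    ultimately have "norm (z - clip R z) \<le> 1 * norm z"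
      by (simp only: norm_scaleR real_norm_def abs_of_nonneg mult_right_mono norm_ge_zero)
    also have "\<dots> \<le> norm z * (norm z / R)" using mult_left_mono[of 1 "norm z / R" "norm z"] gt by simp
    finally show ?thesis by (simp add: power2_eq_square)
  qed
  have intY: "integrable M (Y n)" for n
  proof (rule Bochner_Integration.integrable_bound)
    show "integrable M (\<lambda>x. 1 + (norm (Y n x))\<^sup>2)" using L2(1) by simp
    have "t \<le> 1 + t\<^sup>2" if "0 \<le> t" for t :: real
      using zero_le_power2[of "t - 1"] that by (simp add: power2_diff) 
    then show "AE x in M. norm (Y n x) \<le> norm (1 + (norm (Y n x))\<^sup>2)" by auto
  qed simp
  have intc: "integrable M (\<lambda>x. clip R (V x))" if "0 < R" "V \<in> borel_measurable M" for R V
    using that by (intro integrable_const_bound[where B=R]) (auto simp: clip_bd)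
  show ?thesis
  proof (rule LIMSEQ_I)
    fix \<epsilon> :: real assume \<epsilon>: "0 < \<epsilon>"
    have C0: "0 \<le> C" using order_trans[OF _ L2(2)[of 0]] by simp
    define R where "R = 1 + 2 * C / \<epsilon>"
    have R: "R \<ge> 1" "C / R < \<epsilon>"
    proof -
      show 1: "R \<ge> 1" using C0 \<epsilon> by (simp add: R_def)
      have "C < \<epsilon> * R" using C0 \<epsilon> by (simp add: R_def algebra_simps)
      then show "C / R < \<epsilon>" using 1 by (simp add: field_simps)
    qed
    have "(\<lambda>n. \<integral>x. clip R (Y n x) \<partial>M) \<longlonglongrightarrow> (\<integral>x. clip R (Z x) \<partial>M)"
    proof (rule integral_dominated_convergence[where w="\<lambda>_. R"])
      show "AE x in M. (\<lambda>n. clip R (Y n x)) \<longlonglongrightarrow> clip R (Z x)"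
        using lim
      proof eventually_elim
        case (elim x)
        then show ?case unfolding clip_def
          using R(1) by (intro tendsto_intros) (auto simp: max_def)
      qed
      show "AE x in M. norm (clip R (Y n x)) \<le> R" for n using R(1) by (auto intro!: clip_bd)
    qed auto
    moreover have "(\<integral>x. clip R (Z x) \<partial>M) = (\<integral>x. Z x \<partial>M)"
    proof (rule integral_cong_AE)
      show "AE x in M. clip R (Z x) = Z x" using bd
      proof eventually_elim
        case (elim x)
        then have "norm (Z x) / R \<le> 1" using R(1) by (simp add: field_simps)
        then show ?case by (simp add: clip_def max_def)
      qed
    qed auto
    moreover have "0 < \<epsilon> - C / R" using R by simp
    ultimately obtain n0 where n0: "\<And>n. n \<ge> n0 \<Longrightarrow> norm ((\<integral>x. clip R (Y n x) \<partial>M) - (\<integral>x. Z x \<partial>M)) < \<epsilon> - C / R"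
      using LIMSEQ_D by metis
    have "norm ((\<integral>x. Y n x \<partial>M) - (\<integral>x. Z x \<partial>M)) < \<epsilon>" if "n \<ge> n0" for n
    proof -
      have "norm ((\<integral>x. Y n x \<partial>M) - (\<integral>x. clip R (Y n x) \<partial>M)) = norm (\<integral>x. Y n x - clip R (Y n x) \<partial>M)"
        using R(1) by (subst Bochner_Integration.integral_diff[OF intY intc]) auto
      also have "\<dots> \<le> (\<integral>x. (norm (Y n x))\<^sup>2 / R \<partial>M)"
      proof (rule order_trans[OF integral_norm_bound Bochner_Integration.integral_mono])
        show "integrable M (\<lambda>x. norm (Y n x - clip R (Y n x)))" using intY[of n] intc[of R "Y n"] R(1) by simp
        show "integrable M (\<lambda>x. (norm (Y n x))\<^sup>2 / R)" using L2(1) by simp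
        show "norm (Y n x - clip R (Y n x)) \<le> (norm (Y n x))\<^sup>2 / R" for x
          using R(1) by (intro clip_diff) simp
      qed
      also have "\<dots> \<le> C / R" using L2(2)[of n] R(1) by (simp add: divide_right_mono)
      finally have "norm ((\<integral>x. Y n x \<partial>M) - (\<integral>x. clip R (Y n x) \<partial>M)) \<le> C / R" .
      with n0[OF that] show ?thesis
        using norm_triangle_ineq[of "(\<integral>x. Y n x \<partial>M) - (\<integral>x. clip R (Y n x) \<partial>M)"
          "(\<integral>x. clip R (Y n x) \<partial>M) - (\<integral>x. Z x \<partial>M)"] by simp
    qed
    then show "\<exists>no. \<forall>n\<ge>no. norm ((\<integral>x. Y n x \<partial>M) - (\<integral>x. Z x \<partial>M)) < \<epsilon>" by blast
  qed
qed

text \<open>Passes the factorization through a pointwise limit of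
  events. It replaces an argument with generated \<open>\<sigma>\<close>-algebras when survival events are
  approximated by events that depend on finitely many times.\<close>

lemma (in prob_space) independent_integral_limit:
  fixes H \<Psi> :: "'a \<Rightarrow> complex"
  assumes H[measurable]: "H \<in> borel_measurable M" and Hb: "\<And>x. norm (H x) \<le> C"
    and \<Psi>: "integrable M \<Psi>"
    and A[measurable]: "\<And>n. A n \<in> events"
    and lim: "\<And>x. (\<lambda>n. indicator (A n) x :: complex) \<longlonglongrightarrow> indicator S x"
    and S[measurable]: "S \<in> events"
    and eq: "\<And>n. expectation (\<lambda>x. H x * indicator (A n) x * \<Psi> x) = expectation (\<lambda>x. H x * indicator (A n) x) * expectation \<Psi>"
  shows "expectation (\<lambda>x. H x * indicator S x * \<Psi> x) = expectation (\<lambda>x. H x * indicator S x) * expectation \<Psi>"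
proof -
  have [measurable]: "\<Psi> \<in> borel_measurable M" using \<Psi> by simp
  have C: "0 \<le> C" using order_trans[OF norm_ge_zero Hb] .
  have b: "norm (H x * indicator T x) \<le> C" for x T
    using Hb[of x] C by (simp add: indicator_def)
  have "(\<lambda>n. expectation (\<lambda>x. H x * indicator (A n) x * \<Psi> x)) \<longlonglongrightarrow> expectation (\<lambda>x. H x * indicator S x * \<Psi> x)"
  proof (rule integral_dominated_convergence[where w="\<lambda>x. C * norm (\<Psi> x)"])
    show "AE x in M. (\<lambda>n. H x * indicator (A n) x * \<Psi> x) \<longlonglongrightarrow> H x * indicator S x * \<Psi> x"
      by (intro AE_I2 tendsto_mult tendsto_const lim)
    show "AE x in M. norm (H x * indicator (A n) x * \<Psi> x) \<le> C * norm (\<Psi> x)" for n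
      unfolding norm_mult[of "_ * _"] by (intro AE_I2 mult_right_mono b) auto
  qed (use \<Psi> in auto)
  moreover have "(\<lambda>n. expectation (\<lambda>x. H x * indicator (A n) x)) \<longlonglongrightarrow> expectation (\<lambda>x. H x * indicator S x)"
  proof (rule integral_dominated_convergence[where w="\<lambda>x. C"])
    show "AE x in M. (\<lambda>n. H x * indicator (A n) x) \<longlonglongrightarrow> H x * indicator S x"
      by (intro AE_I2 tendsto_mult tendsto_const lim)
    show "AE x in M. norm (H x * indicator (A n) x) \<le> C" for n
      by (intro AE_I2 b)
  qed auto
  then have "(\<lambda>n. expectation (\<lambda>x. H x * indicator (A n) x) * expectation \<Psi>) \<longlonglongrightarrow>
      expectation (\<lambda>x. H x * indicator S x) * expectation \<Psi>"
    by (intro tendsto_mult tendsto_const)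
  ultimately show ?thesis unfolding eq by (rule LIMSEQ_unique)
qed

section \<open>Exponentials of Gaussian increments\<close>

lemma (in prob_space) normal_exponential_moment:
  assumes X: "distributed M lborel X (normal_density 0 \<sigma>)" and \<sigma>: "0 < \<sigma>"
  shows "integrable M (\<lambda>\<omega>. exp (c * X \<omega>))" "expectation (\<lambda>\<omega>. exp (c * X \<omega>)) = exp (c\<^sup>2 * \<sigma>\<^sup>2 / 2)"
proof -
  have *: "normal_density 0 \<sigma> x * exp (c * x) = exp (c\<^sup>2 * \<sigma>\<^sup>2 / 2) * normal_density (c * \<sigma>\<^sup>2) \<sigma> x" for x
  proof -
    have "- (x - 0)\<^sup>2 / (2 * \<sigma>\<^sup>2) + c * x = c\<^sup>2 * \<sigma>\<^sup>2 / 2 + - (x - c * \<sigma>\<^sup>2)\<^sup>2 / (2 * \<sigma>\<^sup>2)"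
      using \<sigma> by (simp add: field_simps power2_eq_square)
    then have "exp (- (x - 0)\<^sup>2 / (2 * \<sigma>\<^sup>2)) * exp (c * x) =
        exp (c\<^sup>2 * \<sigma>\<^sup>2 / 2) * exp (- (x - c * \<sigma>\<^sup>2)\<^sup>2 / (2 * \<sigma>\<^sup>2))"
      by (simp only: exp_add[symmetric])
    then show ?thesis unfolding normal_density_def by (simp add: mult.assoc)
  qed
  have "integrable lborel (\<lambda>x. normal_density 0 \<sigma> x * exp (c * x))"
    unfolding * using \<sigma> by simp
  then show "integrable M (\<lambda>\<omega>. exp (c * X \<omega>))"
    using distributed_integrable[OF X, of "\<lambda>x. exp (c * x)"] by simp
  show "expectation (\<lambda>\<omega>. exp (c * X \<omega>)) = exp (c\<^sup>2 * \<sigma>\<^sup>2 / 2)"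
    using distributed_integral[OF X, of "\<lambda>x. exp (c * x)"] \<sigma> unfolding * by simp
qed

lemma (in prob_space) normal_characteristic_function:
  assumes X: "distributed M lborel X (normal_density 0 \<sigma>)" and \<sigma>: "0 < \<sigma>"
  shows "expectation (\<lambda>\<omega>. iexp (c * X \<omega>)) = complex_of_real (exp (- (c\<^sup>2 * \<sigma>\<^sup>2) / 2))"
proof -
  have Y: "distributed M lborel (\<lambda>\<omega>. X \<omega> / \<sigma>) std_normal_density"
    using X normal_standard_normal_convert[OF \<sigma>, of X 0] by simp
  have [measurable]: "(\<lambda>\<omega>. X \<omega> / \<sigma>) \<in> borel_measurable M"
    using distributed_measurable[OF Y] by simp
  have "distr M lborel (\<lambda>\<omega>. X \<omega> / \<sigma>) = std_normal_distribution"
    using Y by (rule distributed_distr_eq_density)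
  then have "char (distr M lborel (\<lambda>\<omega>. X \<omega> / \<sigma>)) (c * \<sigma>) = complex_of_real (exp (- ((c * \<sigma>)\<^sup>2) / 2))"
    by (simp add: char_std_normal_distribution)
  moreover have "char (distr M lborel (\<lambda>\<omega>. X \<omega> / \<sigma>)) (c * \<sigma>) = expectation (\<lambda>\<omega>. iexp (c * X \<omega>))"
    unfolding char_def by (subst integral_distr) (use \<sigma> in \<open>auto simp: mult.assoc\<close>)
  ultimately show ?thesis by (simp add: power_mult_distrib)
qed

context planar_brownian_motion
begin

lemma borel_measurable_increment [measurable (raw)]:
  "0 \<le> s \<Longrightarrow> 0 \<le> t \<Longrightarrow> (\<lambda>\<omega>. B t \<omega> - B s \<omega>) \<in> borel_measurable M"
  using measurable_B[of s] measurable_B[of t] by measurable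

text \<open>The martingale property of \<open>exp (i l B)\<close>: the real part of an increment contributes
  the factor \<open>exp (-l\<^sup>2 (t - s) / 2)\<close>, the independent imaginary part contributes its inverse.
  Analytically, \<open>exp (i l z)\<close> is holomorphic and hence harmonic.\<close>

lemma exp_increment:
  assumes st: "0 \<le> s" "s < t"
  shows "integrable M (\<lambda>\<omega>. exp (\<i> * complex_of_real l * (B t \<omega> - B s \<omega>)))"
    and "expectation (\<lambda>\<omega>. exp (\<i> * complex_of_real l * (B t \<omega> - B s \<omega>))) = 1"
proof -
  let ?X = "\<lambda>\<omega>. Re (B t \<omega> - B s \<omega>)" and ?Y = "\<lambda>\<omega>. Im (B t \<omega> - B s \<omega>)"
  have \<sigma>: "0 < sqrt (t - s)" "(sqrt (t - s))\<^sup>2 = t - s" using st by auto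
  have [measurable]: "(\<lambda>\<omega>. B t \<omega> - B s \<omega>) \<in> borel_measurable M"
    using st by (intro borel_measurable_increment) auto
  have eq: "exp (\<i> * complex_of_real l * (B t \<omega> - B s \<omega>)) =
     iexp (l * ?X \<omega>) * complex_of_real (exp ((-l) * ?Y \<omega>))" for \<omega>
  proof -
    have "\<i> * complex_of_real l * (B t \<omega> - B s \<omega>) = \<i> * complex_of_real (l * ?X \<omega>) + complex_of_real ((-l) * ?Y \<omega>)"
      by (simp add: complex_eq_iff)
    then show ?thesis by (simp only: exp_add exp_of_real)
  qed
  have ind: "indep_var borel (\<lambda>\<omega>. iexp (l * ?X \<omega>)) borel (\<lambda>\<omega>. complex_of_real (exp ((-l) * ?Y \<omega>)))"
    using indep_var_compose[OF indep_Re_Im[OF st], of "\<lambda>x. iexp (l * x)" borel "\<lambda>y. complex_of_real (exp ((-l) * y))" borel]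
    by (simp add: o_def)
  have i1: "integrable M (\<lambda>\<omega>. iexp (l * ?X \<omega>))"
  proof (rule integrable_const_bound[where B=1])
    show "(\<lambda>\<omega>. iexp (l * ?X \<omega>)) \<in> borel_measurable M" by measurable
  qed simp
  have i2: "integrable M (\<lambda>\<omega>. complex_of_real (exp ((-l) * ?Y \<omega>)))"
    using normal_exponential_moment(1)[OF Im_increment[OF st] \<sigma>(1), of "-l"] by (intro integrable_of_real)
  show "integrable M (\<lambda>\<omega>. exp (\<i> * complex_of_real l * (B t \<omega> - B s \<omega>)))"
    unfolding eq by (rule indep_var_integrable[OF ind i1 i2])
  have "expectation (\<lambda>\<omega>. exp (\<i> * complex_of_real l * (B t \<omega> - B s \<omega>))) =
     complex_of_real (exp (- (l\<^sup>2 * (t - s)) / 2)) * complex_of_real (exp ((-l)\<^sup>2 * (t - s) / 2))"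
    unfolding eq indep_var_lebesgue_integral[OF ind i1 i2]
      normal_characteristic_function[OF Re_increment[OF st] \<sigma>(1)] integral_complex_of_real
      normal_exponential_moment(2)[OF Im_increment[OF st] \<sigma>(1)] \<sigma>(2) ..
  also have "\<dots> = complex_of_real (exp (- (l\<^sup>2 * (t - s)) / 2 + (-l)\<^sup>2 * (t - s) / 2))"
    by (simp only: exp_add of_real_mult)
  also have "\<dots> = 1" by simp
  finally show "expectation (\<lambda>\<omega>. exp (\<i> * complex_of_real l * (B t \<omega> - B s \<omega>))) = 1" .
qed

lemma exp_Im_increment:
  assumes st: "0 \<le> s" "s < t"
  shows "integrable M (\<lambda>\<omega>. complex_of_real (exp (c * Im (B t \<omega> - B s \<omega>))))"
    and "expectation (\<lambda>\<omega>. complex_of_real (exp (c * Im (B t \<omega> - B s \<omega>)))) = complex_of_real (exp (c\<^sup>2 * (t - s) / 2))"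
proof -
  have \<sigma>: "0 < sqrt (t - s)" "(sqrt (t - s))\<^sup>2 = t - s" using st by auto
  note * = normal_exponential_moment[OF Im_increment[OF st] \<sigma>(1), of c]
  show "integrable M (\<lambda>\<omega>. complex_of_real (exp (c * Im (B t \<omega> - B s \<omega>))))"
    using *(1) by (intro integrable_of_real)
  show "expectation (\<lambda>\<omega>. complex_of_real (exp (c * Im (B t \<omega> - B s \<omega>)))) = complex_of_real (exp (c\<^sup>2 * (t - s) / 2))"
    unfolding integral_complex_of_real *(2) \<sigma>(2) ..
qed

section \<open>Independence of an increment and survival up to its start\<close>

text \<open>On a finite grid that starts at time 0 the past is a
  function of the increments, because the starting point is almost surely the constant \<open>a\<close>;
  these increments are independent of the next one.\<close>

lemma expectation_grid_past_times_increment: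
  fixes h \<psi> :: "complex \<Rightarrow> complex" and \<tau> :: "nat \<Rightarrow> real"
  assumes \<tau>0: "\<tau> 0 = 0" and mono: "\<And>i. i < m \<Longrightarrow> \<tau> i \<le> \<tau> (Suc i)" and t: "\<tau> m \<le> t"
    and h[measurable]: "h \<in> borel_measurable borel" and hb: "\<And>z. norm (h z) \<le> C"
    and \<psi>[measurable]: "\<psi> \<in> borel_measurable borel"
    and i\<psi>: "integrable M (\<lambda>\<omega>. \<psi> (B t \<omega> - B (\<tau> m) \<omega>))"
    and F[measurable]: "F \<in> sets borel"
  shows "expectation (\<lambda>\<omega>. h (B (\<tau> m) \<omega>) * indicator {\<omega>. \<forall>j\<le>m. B (\<tau> j) \<omega> \<in> F} \<omega> * \<psi> (B t \<omega> - B (\<tau> m) \<omega>)) =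
    expectation (\<lambda>\<omega>. h (B (\<tau> m) \<omega>) * indicator {\<omega>. \<forall>j\<le>m. B (\<tau> j) \<omega> \<in> F} \<omega>) *
    expectation (\<lambda>\<omega>. \<psi> (B t \<omega> - B (\<tau> m) \<omega>))"
proof -
  \<comment> \<open>the grid extended by \<open>t\<close>, so that the last increment is the future one\<close>
  define \<tau>' where "\<tau>' = \<tau>(Suc m := t)"
  define D where "D i \<omega> = B (\<tau>' (Suc i)) \<omega> - B (\<tau>' i) \<omega>" for i \<omega>
  define G where "G v = h (a + (\<Sum>i<m. v i)) *
     (if \<forall>j\<le>m. a + (\<Sum>i<j. v i) \<in> F then 1 else 0)" for v :: "nat \<Rightarrow> complex"
  have \<tau>'m: "\<tau>' j = \<tau> j" if "j \<le> m" for j using that by (simp add: \<tau>'_def)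
  have pos: "0 \<le> \<tau> j" if "j \<le> m" for j
    using that by (induction j) (use \<tau>0 mono order_trans in \<open>auto simp: Suc_le_eq\<close>)
  have ind: "indep_vars (\<lambda>_. borel) D {..<Suc m}"
    unfolding D_def[abs_def]
  proof (rule indep_increments)
    show "0 \<le> \<tau>' 0" by (simp add: \<tau>'m \<tau>0)
    show "\<tau>' i \<le> \<tau>' (Suc i)" if "i < Suc m" for i
      using that mono[of i] t by (cases "i = m") (auto simp: \<tau>'_def)
  qed
  have "indep_var (PiM {..<m} (\<lambda>_. borel)) (\<lambda>\<omega>. restrict (\<lambda>i. D i \<omega>) {..<m})
      (PiM {m} (\<lambda>_. borel)) (\<lambda>\<omega>. restrict (\<lambda>i. D i \<omega>) {m})"
    by (rule indep_var_restrict[OF ind]) auto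
  note past_future = this
  have G: "G \<in> borel_measurable (PiM {..<m} (\<lambda>_. borel))"
  proof -
    have [measurable]: "(\<lambda>v. a + (\<Sum>i<j. v i)) \<in> borel_measurable (PiM {..<m} (\<lambda>_. borel))" if "j \<le> m" for j
      using that by (intro borel_measurable_add borel_measurable_const borel_measurable_sum measurable_component_singleton) auto
    have "Measurable.pred (PiM {..<m} (\<lambda>_. borel)) (\<lambda>v. \<forall>j\<in>{..m}. a + (\<Sum>i<j. v i) \<in> F)"
      by (intro pred_intros_finite pred_sets2[OF F]) auto
    then have [measurable]: "Measurable.pred (PiM {..<m} (\<lambda>_. borel)) (\<lambda>v. \<forall>j\<le>m. a + (\<Sum>i<j. v i) \<in> F)"
      by (simp add: Ball_def)
    have [measurable]: "(\<lambda>v. h (a + (\<Sum>i<m. v i))) \<in> borel_measurable (PiM {..<m} (\<lambda>_. borel))"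
      by (rule measurable_compose[OF _ h]) simp
    show ?thesis unfolding G_def[abs_def] by measurable
  qed
  have "(\<lambda>v. \<psi> (v m)) \<in> borel_measurable (PiM {m} (\<lambda>_. borel))" by measurable
  from indep_var_compose[OF past_future G this] have iv: "indep_var borel (\<lambda>\<omega>. G (restrict (\<lambda>i. D i \<omega>) {..<m})) borel (\<lambda>\<omega>. \<psi> (D m \<omega>))"
    by (simp add: o_def)
  have Dm: "D m \<omega> = B t \<omega> - B (\<tau> m) \<omega>" for \<omega> by (simp add: D_def \<tau>'_def)
  have i1: "integrable M (\<lambda>\<omega>. G (restrict (\<lambda>i. D i \<omega>) {..<m}))"
  proof (rule integrable_const_bound[where B="\<bar>C\<bar>"])
    show "(\<lambda>\<omega>. G (restrict (\<lambda>i. D i \<omega>) {..<m})) \<in> borel_measurable M"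
      using iv indep_var_rv1 by blast
    show "AE \<omega> in M. norm (G (restrict (\<lambda>i. D i \<omega>) {..<m})) \<le> \<bar>C\<bar>"
    proof (rule AE_I2)
      fix \<omega>
      have "norm (h z) \<le> \<bar>C\<bar>" for z using hb[of z] by linarith
      then show "norm (G (restrict (\<lambda>i. D i \<omega>) {..<m})) \<le> \<bar>C\<bar>" by (simp add: G_def)
    qed
  qed
  have AEG: "AE \<omega> in M. G (restrict (\<lambda>i. D i \<omega>) {..<m}) =
      h (B (\<tau> m) \<omega>) * indicator {\<omega>. \<forall>j\<le>m. B (\<tau> j) \<omega> \<in> F} \<omega>"
    using start
  proof eventually_elim
    case (elim \<omega>)
    have "a + (\<Sum>i<j. D i \<omega>) = B (\<tau> j) \<omega>" if "j \<le> m" for j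
    proof -
      have "(\<Sum>i<j. D i \<omega>) = B (\<tau>' j) \<omega> - B (\<tau>' 0) \<omega>"
        unfolding D_def by (rule sum_lessThan_telescope)
      then show ?thesis using that elim by (simp add: \<tau>'m \<tau>0)
    qed
    then have "a + (\<Sum>i<j. restrict (\<lambda>i. D i \<omega>) {..<m} i) = B (\<tau> j) \<omega>" if "j \<le> m" for j
      using that by simp
    then show ?case unfolding G_def by (simp add: indicator_def)
  qed
  have [measurable]: "(\<lambda>\<omega>. h (B (\<tau> m) \<omega>) * indicator {\<omega>. \<forall>j\<le>m. B (\<tau> j) \<omega> \<in> F} \<omega>) \<in> borel_measurable M"
  proof -
    have [measurable]: "B (\<tau> j) \<in> borel_measurable M" if "j \<le> m" for j
      using measurable_B pos that by blast
    have "Measurable.pred M (\<lambda>\<omega>. \<forall>j\<in>{..m}. B (\<tau> j) \<omega> \<in> F)"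
      by (intro pred_intros_finite pred_sets2[OF F]) auto
    then have [measurable]: "Measurable.pred M (\<lambda>\<omega>. \<forall>j\<le>m. B (\<tau> j) \<omega> \<in> F)"
      by (simp add: Ball_def)
    have "(\<lambda>\<omega>. h (B (\<tau> m) \<omega>) * (if \<forall>j\<le>m. B (\<tau> j) \<omega> \<in> F then 1 else 0)) \<in> borel_measurable M"
      by measurable
    then show ?thesis by (simp add: indicator_def[abs_def])
  qed
  have [measurable]: "(\<lambda>\<omega>. G (restrict (\<lambda>i. D i \<omega>) {..<m})) \<in> borel_measurable M"
    using i1 by simp
  have [measurable]: "(\<lambda>\<omega>. \<psi> (B t \<omega> - B (\<tau> m) \<omega>)) \<in> borel_measurable M"
    using i\<psi> by simp
  have "expectation (\<lambda>\<omega>. h (B (\<tau> m) \<omega>) * indicator {\<omega>. \<forall>j\<le>m. B (\<tau> j) \<omega> \<in> F} \<omega> * \<psi> (B t \<omega> - B (\<tau> m) \<omega>)) =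
     expectation (\<lambda>\<omega>. G (restrict (\<lambda>i. D i \<omega>) {..<m}) * \<psi> (D m \<omega>))"
    using AEG by (intro integral_cong_AE) (auto simp: Dm elim!: eventually_mono)
  also have "\<dots> = expectation (\<lambda>\<omega>. G (restrict (\<lambda>i. D i \<omega>) {..<m})) * expectation (\<lambda>\<omega>. \<psi> (D m \<omega>))"
    using i\<psi> by (intro indep_var_lebesgue_integral[OF iv i1]) (simp add: Dm)
  also have "expectation (\<lambda>\<omega>. G (restrict (\<lambda>i. D i \<omega>) {..<m})) =
      expectation (\<lambda>\<omega>. h (B (\<tau> m) \<omega>) * indicator {\<omega>. \<forall>j\<le>m. B (\<tau> j) \<omega> \<in> F} \<omega>)"
    using AEG by (intro integral_cong_AE) auto
  finally show ?thesis by (simp add: Dm)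
qed

end

lemma dyadic_floor_tendsto:
  fixes s r :: real
  assumes "0 < s" "0 \<le> r" "r \<le> s"
  shows "(\<lambda>n. s * real (nat \<lfloor>2 ^ n * r / s\<rfloor>) / 2 ^ n) \<longlonglongrightarrow> r"
    and "nat \<lfloor>2 ^ n * r / s\<rfloor> \<le> 2 ^ n"
proof -
  have fl: "real (nat \<lfloor>2 ^ n * r / s\<rfloor>) = real_of_int \<lfloor>2 ^ n * r / s\<rfloor>" for n :: nat
    using assms by (intro of_nat_nat) auto
  have e: "\<bar>s * real (nat \<lfloor>2 ^ n * r / s\<rfloor>) / 2 ^ n - r\<bar> \<le> s * (1 / 2) ^ n" for n :: nat
  proof -
    define q where "q = real_of_int \<lfloor>2 ^ n * r / s\<rfloor>"
    have q: "q \<le> 2 ^ n * r / s" "2 ^ n * r / s < q + 1" unfolding q_def by linarith+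
    have r: "r = s * (2 ^ n * r / s) / 2 ^ n" using assms by simp
    have "s * q / 2 ^ n - r = s * (q - 2 ^ n * r / s) / 2 ^ n" using assms by (simp add: field_simps)
    moreover have "\<bar>s * (q - 2 ^ n * r / s) / 2 ^ n\<bar> \<le> s * 1 / 2 ^ n"
    proof -
      have "\<bar>q - 2 ^ n * r / s\<bar> \<le> 1" using q by linarith
      then have "s * \<bar>q - 2 ^ n * r / s\<bar> / 2 ^ n \<le> s * 1 / 2 ^ n"
        using assms by (intro divide_right_mono mult_left_mono) auto
      then show ?thesis using assms by (simp add: abs_mult)
    qed
    ultimately show ?thesis unfolding fl q_def[symmetric] by (simp add: power_one_over field_simps)
  qed
  have "(\<lambda>n. s * (1 / 2) ^ n) \<longlonglongrightarrow> s * 0"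
    by (intro tendsto_mult tendsto_const LIMSEQ_power_zero) simp
  then have z: "(\<lambda>n. s * (1 / 2) ^ n) \<longlonglongrightarrow> 0" by simp
  have "(\<lambda>n. s * real (nat \<lfloor>2 ^ n * r / s\<rfloor>) / 2 ^ n - r) \<longlonglongrightarrow> 0"
    by (rule Lim_null_comparison[OF _ z]) (use e in \<open>auto intro!: always_eventually\<close>)
  then show "(\<lambda>n. s * real (nat \<lfloor>2 ^ n * r / s\<rfloor>) / 2 ^ n) \<longlonglongrightarrow> r"
    by (simp add: LIM_zero_iff)
  have "2 ^ n * r / s \<le> 2 ^ n" using assms by (simp add: field_simps)
  then have "\<lfloor>2 ^ n * r / s\<rfloor> \<le> \<lfloor>2 ^ n :: real\<rfloor>" by (rule floor_mono)
  also have "\<lfloor>2 ^ n :: real\<rfloor> = int (2 ^ n)" by (metis floor_of_nat of_nat_numeral of_nat_power)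
  finally show "nat \<lfloor>2 ^ n * r / s\<rfloor> \<le> 2 ^ n" by simp
qed

text \<open>Closed sets that exhaust an open \<open>U\<close>. Staying in a closed set up to time \<open>s\<close> can be tested
  at countably many times; staying in an open set cannot.\<close>

definition inner_core :: "complex set \<Rightarrow> nat \<Rightarrow> complex set" where
  "inner_core U m = {z. \<forall>y\<in>-U. 1 / real (Suc m) \<le> dist z y}"

lemma closed_inner_core: "closed (inner_core U m)"
proof -
  have "inner_core U m = (\<Inter>y\<in>-U. {z. 1 / real (Suc m) \<le> dist z y})" by (auto simp: inner_core_def)
  moreover have "closed {z. 1 / real (Suc m) \<le> dist z y}" for y :: complex
    by (intro closed_Collect_le continuous_intros)
  ultimately show ?thesis by auto
qed

context planar_brownian_motion
begin

definition survival :: "complex set \<Rightarrow> real \<Rightarrow> 'w set" where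
  "survival U t = {\<omega> \<in> space M. \<forall>s\<in>{0..t}. B s \<omega> \<in> U}"

definition grid_survival :: "complex set \<Rightarrow> real \<Rightarrow> nat \<Rightarrow> 'w set" where
  "grid_survival F s n = {\<omega> \<in> space M. \<forall>j\<le>2 ^ n. B (s * real j / 2 ^ n) \<omega> \<in> F}"

lemma path_continuous: "\<omega> \<in> space M \<Longrightarrow> continuous_on {0..t} (\<lambda>r. B r \<omega>)"
  using continuous_paths by (rule continuous_on_subset) auto

lemma grid_survival_events [measurable]:
  assumes "0 \<le> s" "F \<in> sets borel"
  shows "grid_survival F s n \<in> events"
proof -
  have [measurable]: "B (s * real j / 2 ^ n) \<in> borel_measurable M" for j :: nat
    using assms(1) by (intro measurable_B) auto
  have "Measurable.pred M (\<lambda>\<omega>. \<forall>j\<in>{..(2::nat) ^ n}. B (s * real j / 2 ^ n) \<omega> \<in> F)"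
    by (intro pred_intros_finite pred_sets2[OF assms(2)]) auto
  then show ?thesis unfolding grid_survival_def pred_def Ball_def atMost_iff .
qed

lemma decseq_grid_survival: "decseq (grid_survival F s)"
proof (rule decseq_SucI)
  fix n show "grid_survival F s (Suc n) \<subseteq> grid_survival F s n"
  proof
    fix \<omega> assume \<omega>: "\<omega> \<in> grid_survival F s (Suc n)"
    have "B (s * real j / 2 ^ n) \<omega> \<in> F" if "j \<le> 2 ^ n" for j
    proof -
      have "\<forall>i\<le>2 ^ Suc n. B (s * real i / 2 ^ Suc n) \<omega> \<in> F"
        using \<omega> unfolding grid_survival_def by blast
      moreover have "2 * j \<le> 2 ^ Suc n" using that by simp
      ultimately have "B (s * real (2 * j) / 2 ^ Suc n) \<omega> \<in> F" by blast
      moreover have "s * real (2 * j) / 2 ^ Suc n = s * real j / 2 ^ n" by simp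
      ultimately show ?thesis by (simp only:)
    qed
    then show "\<omega> \<in> grid_survival F s n" using \<omega> unfolding grid_survival_def by blast
  qed
qed

lemma INT_grid_survival:
  assumes F: "closed F" and s: "0 \<le> s"
  shows "(\<Inter>n. grid_survival F s n) = survival F s"
proof (intro equalityI subsetI)
  fix \<omega> assume \<omega>: "\<omega> \<in> (\<Inter>n. grid_survival F s n)"
  then have sp: "\<omega> \<in> space M" by (auto simp: grid_survival_def)
  have g: "B (s * real j / 2 ^ n) \<omega> \<in> F" if "j \<le> 2 ^ n" for j n
    using \<omega> that unfolding grid_survival_def by blast
  have "B r \<omega> \<in> F" if r: "0 \<le> r" "r \<le> s" for r
  proof (cases "s = 0")
    case True
    then show ?thesis using g[of 0 0] r by simp
  next
    case False
    then have s0: "0 < s" using s by simp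
    let ?r = "\<lambda>n. s * real (nat \<lfloor>2 ^ n * r / s\<rfloor>) / 2 ^ n"
    have "(\<lambda>n. B (?r n) \<omega>) \<longlonglongrightarrow> B r \<omega>"
      using r s by (intro continuous_on_tendsto_compose[OF continuous_paths[OF sp]] dyadic_floor_tendsto[OF s0]) auto
    moreover have "B (?r n) \<omega> \<in> F" for n
      using dyadic_floor_tendsto(2)[OF s0 r] by (rule g)
    ultimately show ?thesis
      using closed_sequentially[OF F, of "\<lambda>n. B (?r n) \<omega>" "B r \<omega>"] by simp
  qed
  then show "\<omega> \<in> survival F s" using sp by (simp add: survival_def)
next
  fix \<omega> assume \<omega>: "\<omega> \<in> survival F s"
  have "s * real j / 2 ^ n \<in> {0..s}" if "j \<le> 2 ^ n" for j n
  proof -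
    have "real j \<le> 2 ^ n" using that by (metis of_nat_le_iff of_nat_numeral of_nat_power)
    then show ?thesis using s by (auto simp: field_simps intro: mult_left_mono)
  qed
  then show "\<omega> \<in> (\<Inter>n. grid_survival F s n)"
    using \<omega> unfolding survival_def grid_survival_def by blast
qed

lemma incseq_survival_inner_core: "incseq (\<lambda>m. survival (inner_core U m) s)"
proof -
  have "inner_core U m \<subseteq> inner_core U (Suc m)" for m
  proof -
    have "1 / real (Suc (Suc m)) \<le> 1 / real (Suc m)" by (simp add: frac_le)
    then show ?thesis by (auto simp: inner_core_def intro: order_trans)
  qed
  then show ?thesis by (intro incseq_SucI) (auto simp: survival_def)
qed

text \<open>The path up to time \<open>s\<close> is compact, so if it stays in \<open>U\<close> it has positive
  distance to the complement.\<close>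

lemma UN_survival_inner_core:
  assumes U: "open U"
  shows "(\<Union>m. survival (inner_core U m) s) = survival U s"
proof (intro equalityI subsetI)
  fix \<omega> assume "\<omega> \<in> (\<Union>m. survival (inner_core U m) s)"
  moreover have "inner_core U m \<subseteq> U" for m
  proof
    fix z assume z: "z \<in> inner_core U m"
    show "z \<in> U"
    proof (rule ccontr)
      assume "z \<notin> U"
      then have "1 / real (Suc m) \<le> dist z z" using z unfolding inner_core_def by blast
      then show False by simp
    qed
  qed
  ultimately show "\<omega> \<in> survival U s" by (auto simp: survival_def)
next
  fix \<omega> assume \<omega>: "\<omega> \<in> survival U s"
  then have sp: "\<omega> \<in> space M" by (simp add: survival_def)
  have "compact ((\<lambda>r. B r \<omega>) ` {0..s})"
    by (intro compact_continuous_image path_continuous sp) simp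
  moreover have "closed (- U)" using U by (rule closed_Compl)
  moreover have "(\<lambda>r. B r \<omega>) ` {0..s} \<inter> - U = {}" using \<omega> by (auto simp: survival_def)
  ultimately obtain d where d: "d > 0" "\<forall>x\<in>(\<lambda>r. B r \<omega>) ` {0..s}. \<forall>y\<in>-U. d \<le> dist x y"
    using separate_compact_closed by blast
  then obtain m where m: "inverse (real (Suc m)) < d" using reals_Archimedean by blast
  have "\<omega> \<in> survival (inner_core U m) s"
    unfolding survival_def inner_core_def
  proof (intro CollectI conjI sp ballI)
    fix r y assume "r \<in> {0..s}" "y \<in> -U"
    then have "d \<le> dist (B r \<omega>) y" using d(2) by blast
    then show "1 / real (Suc m) \<le> dist (B r \<omega>) y" using m by (simp add: inverse_eq_divide)
  qed
  then show "\<omega> \<in> (\<Union>m. survival (inner_core U m) s)" by blast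
qed

lemma survival_closed_events:
  assumes "closed F" "0 \<le> s"
  shows "survival F s \<in> events"
  unfolding INT_grid_survival[OF assms, symmetric]
  using assms by (intro sets.countable_INT) (auto intro!: grid_survival_events)

lemma survival_events:
  assumes "open U" "0 \<le> s"
  shows "survival U s \<in> events"
  unfolding UN_survival_inner_core[OF assms(1), symmetric]
  using assms by (intro sets.countable_UN) (auto intro!: survival_closed_events closed_inner_core)

text \<open>The simple Markov property in the only form that optional
  stopping needs. From finite grids it passes to survival in a closed set (decreasing limit over
  dyadic grids), then to survival in an open set (increasing limit over the exhaustion).\<close>

lemma expectation_survival_times_increment:
  fixes h \<psi> :: "complex \<Rightarrow> complex"
  assumes U: "open U" and s: "0 \<le> s" and st: "s \<le> t"
    and h[measurable]: "h \<in> borel_measurable borel" and hb: "\<And>z. norm (h z) \<le> C"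
    and \<psi>[measurable]: "\<psi> \<in> borel_measurable borel"
    and i\<psi>: "integrable M (\<lambda>\<omega>. \<psi> (B t \<omega> - B s \<omega>))"
  shows "expectation (\<lambda>\<omega>. h (B s \<omega>) * indicator (survival U s) \<omega> * \<psi> (B t \<omega> - B s \<omega>)) =
    expectation (\<lambda>\<omega>. h (B s \<omega>) * indicator (survival U s) \<omega>) *
    expectation (\<lambda>\<omega>. \<psi> (B t \<omega> - B s \<omega>))"
proof -
  have Hm: "(\<lambda>\<omega>. h (B s \<omega>)) \<in> borel_measurable M"
    using measurable_B[OF s] by measurable
  have grid: "expectation (\<lambda>\<omega>. h (B s \<omega>) * indicator (grid_survival F s n) \<omega> * \<psi> (B t \<omega> - B s \<omega>)) =
    expectation (\<lambda>\<omega>. h (B s \<omega>) * indicator (grid_survival F s n) \<omega>) *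
    expectation (\<lambda>\<omega>. \<psi> (B t \<omega> - B s \<omega>))" if F: "closed F" for F n
  proof -
    let ?G = "{\<omega>. \<forall>j\<le>2 ^ n. B (s * real j / 2 ^ n) \<omega> \<in> F}"
    have ind: "indicator (grid_survival F s n) \<omega> = (indicator ?G \<omega> :: complex)" if "\<omega> \<in> space M" for \<omega>
      using that unfolding grid_survival_def indicator_def by simp
    have e1: "s * real (2 ^ n) / 2 ^ n = s" by simp
    have "expectation (\<lambda>\<omega>. h (B (s * real (2 ^ n) / 2 ^ n) \<omega>) * indicator ?G \<omega> * \<psi> (B t \<omega> - B (s * real (2 ^ n) / 2 ^ n) \<omega>)) =
      expectation (\<lambda>\<omega>. h (B (s * real (2 ^ n) / 2 ^ n) \<omega>) * indicator ?G \<omega>) *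
      expectation (\<lambda>\<omega>. \<psi> (B t \<omega> - B (s * real (2 ^ n) / 2 ^ n) \<omega>))"
    proof (rule expectation_grid_past_times_increment[where \<tau>="\<lambda>j. s * real j / 2 ^ n", OF _ _ _ h hb \<psi>])
      show "s * real i / 2 ^ n \<le> s * real (Suc i) / 2 ^ n" for i
        using s by (intro divide_right_mono mult_left_mono) auto
      show "integrable M (\<lambda>\<omega>. \<psi> (B t \<omega> - B (s * real (2 ^ n) / 2 ^ n) \<omega>))"
        unfolding e1 by (rule i\<psi>)
      show "F \<in> sets borel" using F by (rule borel_closed)
    qed (use st in auto)
    moreover have "expectation (\<lambda>\<omega>. h (B s \<omega>) * indicator (grid_survival F s n) \<omega> * \<psi> (B t \<omega> - B s \<omega>)) =
      expectation (\<lambda>\<omega>. h (B s \<omega>) * indicator ?G \<omega> * \<psi> (B t \<omega> - B s \<omega>))"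
      "expectation (\<lambda>\<omega>. h (B s \<omega>) * indicator (grid_survival F s n) \<omega>) =
      expectation (\<lambda>\<omega>. h (B s \<omega>) * indicator ?G \<omega>)"
      by (rule Bochner_Integration.integral_cong, rule refl, simp only: ind)+
    ultimately show ?thesis unfolding e1 by (simp only:)
  qed
  have closed: "expectation (\<lambda>\<omega>. h (B s \<omega>) * indicator (survival F s) \<omega> * \<psi> (B t \<omega> - B s \<omega>)) =
    expectation (\<lambda>\<omega>. h (B s \<omega>) * indicator (survival F s) \<omega>) *
    expectation (\<lambda>\<omega>. \<psi> (B t \<omega> - B s \<omega>))" if F: "closed F" for F
  proof (rule independent_integral_limit[OF Hm hb i\<psi> _ _ _ grid[OF F]])
    show "(\<lambda>n. indicator (grid_survival F s n) \<omega> :: complex) \<longlonglongrightarrow> indicator (survival F s) \<omega>" for \<omega>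
      unfolding INT_grid_survival[OF F s, symmetric]
      by (intro LIMSEQ_indicator_decseq decseq_grid_survival)
  qed (use s F in \<open>auto intro: survival_closed_events grid_survival_events borel_closed\<close>)
  show ?thesis
  proof (rule independent_integral_limit[OF Hm hb i\<psi> _ _ _ closed[OF closed_inner_core]])
    show "(\<lambda>m. indicator (survival (inner_core U m) s) \<omega> :: complex) \<longlonglongrightarrow> indicator (survival U s) \<omega>" for \<omega>
      unfolding UN_survival_inner_core[OF U, symmetric]
      by (intro LIMSEQ_indicator_incseq incseq_survival_inner_core)
  qed (use s U in \<open>auto intro: survival_closed_events survival_events closed_inner_core\<close>)
qed

end

section \<open>Discretized stopping\<close>

text \<open>Openness of \<open>U\<close> gives the strict inequality: a path that is in \<open>U\<close> at time \<open>t\<close>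
  stays in \<open>U\<close> a little longer.\<close>

lemma exit_time_gt_iff:
  assumes U: "open U" and cont: "continuous_on {0..} (\<lambda>t. B t \<omega>)" and t: "0 \<le> t"
  shows "ereal t < exit_time B U \<omega> \<longleftrightarrow> (\<forall>s\<in>{0..t}. B s \<omega> \<in> U)"
proof
  assume "ereal t < exit_time B U \<omega>"
  show "\<forall>s\<in>{0..t}. B s \<omega> \<in> U"
  proof (rule ballI, rule ccontr)
    fix s assume s: "s \<in> {0..t}" "B s \<omega> \<notin> U"
    then have "exit_time B U \<omega> \<le> ereal s" unfolding exit_time_def by (intro Inf_lower) auto
    also have "\<dots> \<le> ereal t" using s by simp
    finally show False using \<open>ereal t < exit_time B U \<omega>\<close> by simp
  qed
next
  assume inU: "\<forall>s\<in>{0..t}. B s \<omega> \<in> U"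
  have "continuous (at t within {0..}) (\<lambda>t. B t \<omega>)"
    using cont t by (simp add: continuous_on_eq_continuous_within)
  moreover have "B t \<omega> \<in> U" using inU t by simp
  ultimately have "\<forall>\<^sub>F s in at t within {0..}. B s \<omega> \<in> U"
    using U unfolding continuous_within tendsto_def by blast
  then obtain d where d: "d > 0" "\<And>s. s \<in> {0..} \<Longrightarrow> s \<noteq> t \<Longrightarrow> dist s t < d \<Longrightarrow> B s \<omega> \<in> U"
    unfolding eventually_at by blast
  have "ereal (t + d) \<le> exit_time B U \<omega>"
    unfolding exit_time_def
  proof (rule Inf_greatest, clarsimp)
    fix s assume s: "0 \<le> s" "B s \<omega> \<notin> U"
    show "t + d \<le> s"
    proof (rule ccontr)
      assume lt: "\<not> t + d \<le> s"
      show False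
      proof (cases "s \<le> t")
        case False
        then have "dist s t < d" using lt by (simp add: dist_real_def)
        then show ?thesis using s d(2)[of s] False by auto
      qed (use s inU in auto)
    qed
  qed
  then show "ereal t < exit_time B U \<omega>" using d(1) by (metis less_add_same_cancel1 less_ereal.simps(1) order_less_le_trans)
qed

lemma exit_time_finite:
  assumes U: "open U" and cont: "continuous_on {0..} (\<lambda>t. B t \<omega>)" and fin: "exit_time B U \<omega> < \<infinity>"
  defines "T \<equiv> real_of_ereal (exit_time B U \<omega>)"
  shows "exit_time B U \<omega> = ereal T" "0 \<le> T" "B T \<omega> \<notin> U"
proof -
  have ge: "0 \<le> exit_time B U \<omega>" unfolding exit_time_def by (intro Inf_greatest) auto
  then show eq: "exit_time B U \<omega> = ereal T" unfolding T_def using fin by (cases "exit_time B U \<omega>") auto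
  then show T: "0 \<le> T" using ge by simp
  show "B T \<omega> \<notin> U"
  proof
    assume BT: "B T \<omega> \<in> U"
    have "\<forall>s\<in>{0..T}. B s \<omega> \<in> U"
    proof
      fix s assume s: "s \<in> {0..T}"
      show "B s \<omega> \<in> U"
      proof (cases "s = T")
        case False
        then have "ereal s < exit_time B U \<omega>" using s eq by simp
        then show ?thesis using exit_time_gt_iff[of U B \<omega> s] U cont s by auto
      qed (use BT in simp)
    qed
    then have "ereal T < exit_time B U \<omega>" using exit_time_gt_iff[of U B \<omega> T] U cont T by simp
    then show False using eq by simp
  qed
qed

definition stop_time :: "(real \<Rightarrow> 'w \<Rightarrow> complex) \<Rightarrow> complex set \<Rightarrow> real \<Rightarrow> 'w \<Rightarrow> real" where
  "stop_time B U N \<omega> = real_of_ereal (min (exit_time B U \<omega>) (ereal N))"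

context planar_brownian_motion
begin

text \<open>The first grid time \<open>k h\<close> that is not before the exit, capped at \<open>K\<close>. It looks at the whole
  path up to \<open>k h\<close> and not at the grid values alone: a path can touch the boundary and return, so
  the first grid value outside \<open>U\<close> need not be close to the exit time.\<close>

definition stop_index :: "complex set \<Rightarrow> real \<Rightarrow> nat \<Rightarrow> 'w \<Rightarrow> nat" where
  "stop_index U h K \<omega> = (LEAST k. k = K \<or> \<omega> \<notin> survival U (real k * h))"

lemma stop_index_le: "stop_index U h K \<omega> \<le> K"
  unfolding stop_index_def by (rule Least_le) simp

lemma survival_antimono: "s \<le> t \<Longrightarrow> survival U t \<subseteq> survival U s"
  by (auto simp: survival_def)

lemma less_stop_index_iff:
  assumes h: "0 \<le> h"
  shows "k < stop_index U h K \<omega> \<longleftrightarrow> k < K \<and> \<omega> \<in> survival U (real k * h)"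
proof
  assume "k < stop_index U h K \<omega>"
  then show "k < K \<and> \<omega> \<in> survival U (real k * h)"
    using not_less_Least[of k "\<lambda>k. k = K \<or> \<omega> \<notin> survival U (real k * h)"] stop_index_le[of U h K \<omega>]
    unfolding stop_index_def by auto
next
  assume k: "k < K \<and> \<omega> \<in> survival U (real k * h)"
  have L: "stop_index U h K \<omega> = K \<or> \<omega> \<notin> survival U (real (stop_index U h K \<omega>) * h)"
    unfolding stop_index_def by (rule LeastI[of _ K]) simp
  show "k < stop_index U h K \<omega>"
  proof (rule ccontr)
    assume "\<not> k < stop_index U h K \<omega>"
    then have le: "stop_index U h K \<omega> \<le> k" by simp
    then have "real (stop_index U h K \<omega>) * h \<le> real k * h" using h by (intro mult_right_mono) auto
    then have "\<omega> \<in> survival U (real (stop_index U h K \<omega>) * h)" using k survival_antimono by blast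
    then show False using L le k by auto
  qed
qed

lemma stopped_telescope:
  fixes f :: "complex \<Rightarrow> complex"
  assumes h: "0 \<le> h"
  shows "f (B (real (stop_index U h K \<omega>) * h) \<omega>) = f (B 0 \<omega>) +
     (\<Sum>k<K. indicator (survival U (real k * h)) \<omega> * (f (B (real (Suc k) * h) \<omega>) - f (B (real k * h) \<omega>)))"
proof -
  let ?g = "\<lambda>k. f (B (real k * h) \<omega>)"
  have "(\<Sum>k<K. indicator (survival U (real k * h)) \<omega> * (?g (Suc k) - ?g k)) =
      (\<Sum>k<K. if k < stop_index U h K \<omega> then ?g (Suc k) - ?g k else 0)"
    using h by (intro sum.cong) (auto simp: less_stop_index_iff indicator_def)
  also have "\<dots> = (\<Sum>k\<in>{k\<in>{..<K}. k < stop_index U h K \<omega>}. ?g (Suc k) - ?g k)"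
    by (rule sum.inter_filter[symmetric]) simp
  also have "{k\<in>{..<K}. k < stop_index U h K \<omega>} = {..<stop_index U h K \<omega>}"
    using stop_index_le[of U h K \<omega>] by auto
  also have "(\<Sum>k<stop_index U h K \<omega>. ?g (Suc k) - ?g k) = ?g (stop_index U h K \<omega>) - ?g 0"
    by (rule sum_lessThan_telescope)
  finally show ?thesis by simp
qed

lemma measurable_stopped:
  assumes U: "open U" and h: "0 \<le> h"
  shows "(\<lambda>\<omega>. B (real (stop_index U h K \<omega>) * h) \<omega>) \<in> borel_measurable M"
proof (rule measurable_compose_countable[where f="\<lambda>k \<omega>. B (real k * h) \<omega>"])
  show "B (real k * h) \<in> borel_measurable M" for k :: nat
    using h by (intro measurable_B) simp
  have [measurable]: "Measurable.pred M (\<lambda>\<omega>. \<omega> \<in> survival U (real k * h))" for k :: nat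
    using survival_events[OF U, of "real k * h"] h by simp
  show "stop_index U h K \<in> M \<rightarrow>\<^sub>M count_space UNIV"
    unfolding stop_index_def[abs_def] by measurable
qed

text \<open>Discrete optional stopping for a multiplicative \<open>f\<close>. In the telescoping sum each
  summand is a bounded function of the past times \<open>f D - 1\<close> for the next increment \<open>D\<close>, and so
  has expectation of modulus at most \<open>norm (c - 1)\<close>. For a martingale \<open>c = 1\<close> and the mean is
  preserved; the case of general \<open>c\<close> serves to bound second moments.\<close>

lemma expectation_stopped:
  fixes f :: "complex \<Rightarrow> complex"
  assumes U: "open U" and h: "0 < h"
    and f[measurable]: "f \<in> borel_measurable borel" and mult: "\<And>z w. f (z + w) = f z * f w"
    and fU: "\<And>z. z \<in> U \<Longrightarrow> norm (f z) \<le> 1"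
    and fint: "\<And>t. 0 \<le> t \<Longrightarrow> integrable M (\<lambda>\<omega>. f (B (t + h) \<omega> - B t \<omega>))"
    and fexp: "\<And>t. 0 \<le> t \<Longrightarrow> expectation (\<lambda>\<omega>. f (B (t + h) \<omega> - B t \<omega>)) = c"
  shows "integrable M (\<lambda>\<omega>. f (B (real (stop_index U h K \<omega>) * h) \<omega>))"
    and "norm (expectation (\<lambda>\<omega>. f (B (real (stop_index U h K \<omega>) * h) \<omega>)) - f a) \<le> real K * norm (c - 1)"
proof -
  have h0: "0 \<le> h" using h by simp
  \<comment> \<open>a globally bounded substitute for \<open>f\<close>; on the survival event the two agree\<close>
  define g where "g z = indicator U z * f z" for z
  have g[measurable]: "g \<in> borel_measurable borel"
    unfolding g_def[abs_def] using U by (intro borel_measurable_times) (auto intro: borel_measurable_indicator)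
  have gb: "norm (g z) \<le> 1" for z using fU by (simp add: g_def indicator_def)
  define d where "d k \<omega> = indicator (survival U (real k * h)) \<omega> * (f (B (real (Suc k) * h) \<omega>) - f (B (real k * h) \<omega>))"
    for k \<omega>
  define \<psi> where "\<psi> z = f z - 1" for z
  have [measurable]: "\<psi> \<in> borel_measurable borel" unfolding \<psi>_def[abs_def] by measurable
  have Suc_h: "real (Suc k) * h = real k * h + h" for k by (simp add: algebra_simps)
  have d: "d k \<omega> = g (B (real k * h) \<omega>) * indicator (survival U (real k * h)) \<omega> *
      \<psi> (B (real k * h + h) \<omega> - B (real k * h) \<omega>)" for k \<omega>
  proof (cases "\<omega> \<in> survival U (real k * h)")
    case True
    have "real k * h \<in> {0..real k * h}" using h by simp
    then have "B (real k * h) \<omega> \<in> U" using True unfolding survival_def by blast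
    moreover have "f (B (real (Suc k) * h) \<omega>) = f (B (real k * h) \<omega>) * f (B (real k * h + h) \<omega> - B (real k * h) \<omega>)"
      unfolding Suc_h mult[symmetric] by simp
    ultimately show ?thesis using True by (simp add: d_def g_def \<psi>_def algebra_simps)
  next
    case False
    then show ?thesis by (simp add: d_def)
  qed
  have tk: "0 \<le> real k * h" for k :: nat using h by simp
  have i\<psi>: "integrable M (\<lambda>\<omega>. \<psi> (B (real k * h + h) \<omega> - B (real k * h) \<omega>))" for k
    unfolding \<psi>_def using fint[OF tk] by simp
  have e\<psi>: "expectation (\<lambda>\<omega>. \<psi> (B (real k * h + h) \<omega> - B (real k * h) \<omega>)) = c - 1" for k
    unfolding \<psi>_def using fint[OF tk] by (simp add: fexp[OF tk] prob_space)
  have [measurable]: "(\<lambda>\<omega>. g (B (real k * h) \<omega>) * indicator (survival U (real k * h)) \<omega>) \<in> borel_measurable M" for k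
    using measurable_B[OF tk, of k] survival_events[OF U tk, of k] by measurable
  have b: "norm (g (B (real k * h) \<omega>) * indicator (survival U (real k * h)) \<omega>) \<le> 1" for k \<omega>
    using gb by (simp add: indicator_def)
  have id: "integrable M (d k)" for k
  proof (rule Bochner_Integration.integrable_bound[OF i\<psi>])
    show "d k \<in> borel_measurable M" unfolding d[abs_def] using i\<psi>[of k] by simp
    show "AE \<omega> in M. norm (d k \<omega>) \<le> norm (\<psi> (B (real k * h + h) \<omega> - B (real k * h) \<omega>))"
      unfolding d norm_mult[of "_ * _"] using b by (intro AE_I2 mult_left_le_one_le) auto
  qed
  have ed: "norm (expectation (d k)) \<le> norm (c - 1)" for k
  proof -
    have "expectation (d k) = expectation (\<lambda>\<omega>. g (B (real k * h) \<omega>) * indicator (survival U (real k * h)) \<omega>) * (c - 1)"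
      unfolding d[abs_def] e\<psi>[of k, symmetric]
      using h by (intro expectation_survival_times_increment[OF U tk _ g gb]) (auto intro: i\<psi>)
    moreover have "norm (expectation (\<lambda>\<omega>. g (B (real k * h) \<omega>) * indicator (survival U (real k * h)) \<omega>)) \<le> 1"
    proof (rule order_trans[OF integral_norm_bound])
      have "integrable M (\<lambda>\<omega>. g (B (real k * h) \<omega>) * indicator (survival U (real k * h)) \<omega>)"
        using b by (intro integrable_const_bound[where B=1]) auto
      then have "expectation (\<lambda>\<omega>. norm (g (B (real k * h) \<omega>) * indicator (survival U (real k * h)) \<omega>)) \<le> expectation (\<lambda>\<omega>. 1)"
        using b by (intro Bochner_Integration.integral_mono integrable_norm) auto
      then show "expectation (\<lambda>\<omega>. norm (g (B (real k * h) \<omega>) * indicator (survival U (real k * h)) \<omega>)) \<le> 1"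
        by (simp add: prob_space)
    qed
    ultimately show ?thesis by (simp add: norm_mult mult_left_le_one_le)
  qed
  have B0[measurable]: "B 0 \<in> borel_measurable M" by (rule measurable_B) simp
  have AE0: "AE \<omega> in M. f (B 0 \<omega>) = f a" using start by eventually_elim simp
  have i0: "integrable M (\<lambda>\<omega>. f (B 0 \<omega>))"
  proof -
    have "integrable M (\<lambda>\<omega>. f a)" by simp
    then show ?thesis using AE0 by (subst integrable_cong_AE[where g="\<lambda>_. f a"]) auto
  qed
  have e0: "expectation (\<lambda>\<omega>. f (B 0 \<omega>)) = f a"
  proof -
    have "expectation (\<lambda>\<omega>. f (B 0 \<omega>)) = expectation (\<lambda>\<omega>. f a)"
      using AE0 by (intro integral_cong_AE) auto
    then show ?thesis by (simp add: prob_space)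
  qed
  have T: "(\<lambda>\<omega>. f (B (real (stop_index U h K \<omega>) * h) \<omega>)) = (\<lambda>\<omega>. f (B 0 \<omega>) + (\<Sum>k<K. d k \<omega>))"
    unfolding d_def by (rule ext) (rule stopped_telescope[OF h0])
  show "integrable M (\<lambda>\<omega>. f (B (real (stop_index U h K \<omega>) * h) \<omega>))"
    unfolding T using i0 id by (intro Bochner_Integration.integrable_add Bochner_Integration.integrable_sum)
  have "expectation (\<lambda>\<omega>. f (B (real (stop_index U h K \<omega>) * h) \<omega>)) = f a + (\<Sum>k<K. expectation (d k))"
    unfolding T using i0 id e0
    by (subst Bochner_Integration.integral_add) (auto intro!: Bochner_Integration.integrable_sum Bochner_Integration.integral_sum)
  then have "norm (expectation (\<lambda>\<omega>. f (B (real (stop_index U h K \<omega>) * h) \<omega>)) - f a) = norm (\<Sum>k<K. expectation (d k))"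
    by simp
  also have "\<dots> \<le> (\<Sum>k<K. norm (c - 1))" by (intro sum_norm_le ed)
  finally show "norm (expectation (\<lambda>\<omega>. f (B (real (stop_index U h K \<omega>) * h) \<omega>)) - f a) \<le> real K * norm (c - 1)"
    by simp
qed

lemma stop_time_bounds:
  assumes \<omega>: "\<omega> \<in> space M" and U: "open U" and N: "0 < N" and K: "0 < K"
  defines "h \<equiv> N / real K"
  shows "stop_time B U N \<omega> \<le> real (stop_index U h K \<omega>) * h"
    and "real (stop_index U h K \<omega>) * h \<le> stop_time B U N \<omega> + h"
proof -
  have h: "0 < h" "real K * h = N" using N K by (simp_all add: h_def)
  have T: "ereal t < exit_time B U \<omega> \<longleftrightarrow> \<omega> \<in> survival U t" if "0 \<le> t" for t
    using exit_time_gt_iff[OF U, of B \<omega> t, OF continuous_paths[OF \<omega>] that] \<omega> by (simp add: survival_def)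
  have ge: "0 \<le> exit_time B U \<omega>" unfolding exit_time_def by (intro Inf_greatest) auto
  define \<tau> where "\<tau> = stop_time B U N \<omega>"
  have \<tau>: "ereal \<tau> = min (exit_time B U \<omega>) (ereal N)"
    unfolding \<tau>_def stop_time_def using ge N by (cases "exit_time B U \<omega>") (auto simp: min_def)
  define k where "k = stop_index U h K \<omega>"
  have "\<tau> \<le> real k * h"
  proof (cases "k = K")
    case True
    have "ereal \<tau> \<le> ereal N" unfolding \<tau> by simp
    then show ?thesis using True h by simp
  next
    case False
    then have "\<omega> \<notin> survival U (real k * h)"
      using less_stop_index_iff[of h k U K \<omega>] h stop_index_le[of U h K \<omega>] by (auto simp: k_def)
    then have "exit_time B U \<omega> \<le> ereal (real k * h)" using T[of "real k * h"] h by (simp add: not_less)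
    then have "ereal \<tau> \<le> ereal (real k * h)" unfolding \<tau> by (simp add: min_le_iff_disj)
    then show ?thesis by simp
  qed
  then show "stop_time B U N \<omega> \<le> real (stop_index U h K \<omega>) * h" by (simp add: \<tau>_def k_def)
  have "real k * h \<le> \<tau> + h"
  proof (cases k)
    case 0
    have "0 \<le> ereal \<tau>" unfolding \<tau> using ge N by simp
    then show ?thesis using 0 h by simp
  next
    case (Suc j)
    then have j: "j < K" "\<omega> \<in> survival U (real j * h)"
      using less_stop_index_iff[of h j U K \<omega>] h by (auto simp: k_def)
    have "ereal (real j * h) < exit_time B U \<omega>" using T[of "real j * h"] j h by simp
    moreover have "real j * h \<le> real K * h" using j h by (intro mult_right_mono) auto
    ultimately have "ereal (real j * h) \<le> ereal \<tau>" unfolding \<tau> using h by simp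
    then show ?thesis using Suc by (simp add: algebra_simps)
  qed
  then show "real (stop_index U h K \<omega>) * h \<le> stop_time B U N \<omega> + h" by (simp add: \<tau>_def k_def)
qed

lemma stop_time_nonneg: "0 < N \<Longrightarrow> 0 \<le> stop_time B U N \<omega>"
proof -
  assume "0 < N"
  moreover have "0 \<le> exit_time B U \<omega>" unfolding exit_time_def by (intro Inf_greatest) auto
  ultimately show ?thesis unfolding stop_time_def by (cases "exit_time B U \<omega>") (auto simp: min_def)
qed

lemma stopped_tendsto:
  assumes \<omega>: "\<omega> \<in> space M" and U: "open U" and N: "0 < N"
  shows "(\<lambda>n. B (real (stop_index U (N / real (Suc n)) (Suc n) \<omega>) * (N / real (Suc n))) \<omega>)
     \<longlonglongrightarrow> B (stop_time B U N \<omega>) \<omega>"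
proof (rule continuous_on_tendsto_compose[OF continuous_paths[OF \<omega>]])
  let ?h = "\<lambda>n. N / real (Suc n)"
  have "(\<lambda>n. N * inverse (real (Suc n))) \<longlonglongrightarrow> N * 0"
    by (intro tendsto_mult tendsto_const LIMSEQ_inverse_real_of_nat)
  then have "?h \<longlonglongrightarrow> 0" by (simp add: divide_inverse)
  then have up: "(\<lambda>n. stop_time B U N \<omega> + ?h n) \<longlonglongrightarrow> stop_time B U N \<omega>"
    using tendsto_add[OF tendsto_const] by fastforce
  show "(\<lambda>n. real (stop_index U (?h n) (Suc n) \<omega>) * ?h n) \<longlonglongrightarrow> stop_time B U N \<omega>"
    by (rule tendsto_sandwich[OF _ _ tendsto_const up])
      (use stop_time_bounds[OF \<omega> U N] in \<open>auto intro!: always_eventually simp del: of_nat_Suc\<close>)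
  show "stop_time B U N \<omega> \<in> {0..}" using stop_time_nonneg[OF N] by simp
  show "\<forall>\<^sub>F n in sequentially. real (stop_index U (?h n) (Suc n) \<omega>) * ?h n \<in> {0..}"
    using N by (intro always_eventually) simp
qed

lemma measurable_stop_time:
  assumes U: "open U" and N: "0 < N"
  shows "(\<lambda>\<omega>. B (stop_time B U N \<omega>) \<omega>) \<in> borel_measurable M"
  by (rule borel_measurable_LIMSEQ_metric[OF measurable_stopped[OF U] stopped_tendsto[OF _ U N]])
    (use N in auto)

section \<open>Optional stopping for exponentials\<close>

lemma AE_stop_time_in_closure:
  assumes U: "open U" and a: "a \<in> U" and N: "0 < N"
  shows "AE \<omega> in M. B (stop_time B U N \<omega>) \<omega> \<in> closure U"
  using start AE_space
proof eventually_elim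
  case (elim \<omega>)
  note cont = continuous_paths[OF elim(2)]
  define \<tau> where "\<tau> = stop_time B U N \<omega>"
  have ge: "0 \<le> exit_time B U \<omega>" unfolding exit_time_def by (intro Inf_greatest) auto
  have \<tau>: "ereal \<tau> = min (exit_time B U \<omega>) (ereal N)"
    unfolding \<tau>_def stop_time_def using ge N by (cases "exit_time B U \<omega>") (auto simp: min_def)
  have "0 < exit_time B U \<omega>"
    using exit_time_gt_iff[OF U, of B \<omega> 0, OF cont] elim(1) a by (simp add: zero_ereal_def)
  then have "0 < ereal \<tau>" unfolding \<tau> using N by (simp add: min_def)
  then have \<tau>0: "0 < \<tau>" by simp
  let ?s = "\<lambda>n. \<tau> * (1 - inverse (real (Suc n)))"
  have le1: "inverse (real (Suc n)) \<le> 1" "0 < inverse (real (Suc n))" for n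
    by (simp_all add: inverse_le_1_iff)
  have s: "0 \<le> ?s n" "?s n < \<tau>" for n
    using \<tau>0 le1[of n] by (simp, simp add: algebra_simps del: of_nat_Suc)
  have "(\<lambda>n. \<tau> * (1 - inverse (real (Suc n)))) \<longlonglongrightarrow> \<tau> * (1 - 0)"
    by (intro tendsto_mult tendsto_diff tendsto_const LIMSEQ_inverse_real_of_nat)
  then have st: "?s \<longlonglongrightarrow> \<tau>" by simp
  have "(\<lambda>n. B (?s n) \<omega>) \<longlonglongrightarrow> B \<tau> \<omega>"
    by (rule continuous_on_tendsto_compose[OF cont st]) (use \<tau>0 s(1) in auto)
  moreover have "B (?s n) \<omega> \<in> closure U" for n
  proof -
    have "ereal (?s n) < ereal \<tau>" using s(2) by simp
    then have "ereal (?s n) < exit_time B U \<omega>" unfolding \<tau> by simp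
    then have "B (?s n) \<omega> \<in> U"
      using exit_time_gt_iff[OF U, of B \<omega> "?s n", OF cont s(1)] s(1)[of n] by simp
    then show ?thesis using closure_subset by blast
  qed
  ultimately have "B \<tau> \<omega> \<in> closure U"
    using closed_sequentially[OF closed_closure, of "\<lambda>n. B (?s n) \<omega>" U "B \<tau> \<omega>"] by blast
  then show ?case by (simp add: \<tau>_def)
qed

text \<open>At the discretized times the path may have left the upper half plane, where
  \<open>exp (i l z)\<close> is unbounded. Its squared modulus \<open>exp (-2 l Im z)\<close> is again multiplicative, so the
  discrete estimate bounds the second moments uniformly in the mesh, and the expectations pass
  to the limit.\<close>

lemma expectation_exp_stopped:
  assumes U: "open U" and a: "a \<in> U" and up: "U \<subseteq> {z. 0 < Im z}" and l: "0 \<le> l" and N: "0 < N"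
  shows "expectation (\<lambda>\<omega>. exp (\<i> * complex_of_real l * B (stop_time B U N \<omega>) \<omega>)) = exp (\<i> * complex_of_real l * a)"
proof -
  define f where "f z = exp (\<i> * complex_of_real l * z)" for z
  define f2 where "f2 z = complex_of_real (exp (- (2 * l) * Im z))" for z
  define h where "h n = N / real (Suc n)" for n
  define X where "X n \<omega> = B (real (stop_index U (h n) (Suc n) \<omega>) * h n) \<omega>" for n \<omega>
  have h: "0 < h n" for n using N by (simp add: h_def)
  have fm[measurable]: "f \<in> borel_measurable borel" unfolding f_def
    by (intro borel_measurable_continuous_onI continuous_intros)
  have f2m[measurable]: "f2 \<in> borel_measurable borel" unfolding f2_def
    by (intro borel_measurable_continuous_onI continuous_intros)
  have nf: "norm (f z) = exp (- l * Im z)" for z by (simp add: f_def norm_exp_eq_Re)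
  have f_le: "norm (f z) \<le> 1" if "0 \<le> Im z" for z using that l by (simp add: nf)
  have f2_le: "norm (f2 z) \<le> 1" if "0 \<le> Im z" for z using that l by (simp add: f2_def)
  have nf2: "(norm (f z))\<^sup>2 = Re (f2 z)" for z
    unfolding nf f2_def by (simp add: exp_double[symmetric])
  have Xm[measurable]: "X n \<in> borel_measurable M" for n
    unfolding X_def[abs_def] using h[of n] by (intro measurable_stopped U) simp
  have f_step: "integrable M (\<lambda>\<omega>. f (B (t + h n) \<omega> - B t \<omega>))"
      "expectation (\<lambda>\<omega>. f (B (t + h n) \<omega> - B t \<omega>)) = 1" if "0 \<le> t" for t n
    unfolding f_def using that h[of n] by (auto intro!: exp_increment)
  have f_mult: "f (z + w) = f z * f w" for z w by (simp add: f_def distrib_left exp_add)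
  have f_U: "norm (f z) \<le> 1" if "z \<in> U" for z using that up by (intro f_le) auto
  note E1 = expectation_stopped[OF U h fm f_mult f_U f_step]
  have f2_step: "integrable M (\<lambda>\<omega>. f2 (B (t + h n) \<omega> - B t \<omega>))"
      "expectation (\<lambda>\<omega>. f2 (B (t + h n) \<omega> - B t \<omega>)) = complex_of_real (exp (2 * l\<^sup>2 * h n))"
    if "0 \<le> t" for t n
  proof -
    have t: "0 \<le> t" "t < t + h n" using that h[of n] by auto
    show "integrable M (\<lambda>\<omega>. f2 (B (t + h n) \<omega> - B t \<omega>))"
      unfolding f2_def by (rule exp_Im_increment(1)[OF t])
    have "(- (2 * l))\<^sup>2 * (t + h n - t) / 2 = 2 * l\<^sup>2 * h n" by (simp add: power_mult_distrib)
    then show "expectation (\<lambda>\<omega>. f2 (B (t + h n) \<omega> - B t \<omega>)) = complex_of_real (exp (2 * l\<^sup>2 * h n))"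
      unfolding f2_def exp_Im_increment(2)[OF t] by (simp only:)
  qed
  have f2_mult: "f2 (z + w) = f2 z * f2 w" for z w by (simp only: f2_def plus_complex.sel distrib_left exp_add of_real_mult)
  have f2_U: "norm (f2 z) \<le> 1" if "z \<in> U" for z using that up by (intro f2_le) auto
  note E2 = expectation_stopped[OF U h f2m f2_mult f2_U f2_step]
  have Ef: "expectation (\<lambda>\<omega>. f (X n \<omega>)) = f a" for n using E1(2)[of n "Suc n"] by (simp add: X_def)
  have "(\<lambda>n. expectation (\<lambda>\<omega>. f (X n \<omega>))) \<longlonglongrightarrow> expectation (\<lambda>\<omega>. f (B (stop_time B U N \<omega>) \<omega>))"
  proof (rule L2_bounded_tendsto_expectation[OF prob_space_axioms, where C="1 + exp (2 * l\<^sup>2 * N)"])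
    show "(\<lambda>\<omega>. f (X n \<omega>)) \<in> borel_measurable M" for n by measurable
    show "(\<lambda>\<omega>. f (B (stop_time B U N \<omega>) \<omega>)) \<in> borel_measurable M"
      by (rule measurable_compose[OF measurable_stop_time[OF U N] fm])
    show "AE \<omega> in M. (\<lambda>n. f (X n \<omega>)) \<longlonglongrightarrow> f (B (stop_time B U N \<omega>) \<omega>)"
    proof (rule AE_I2)
      fix \<omega> assume "\<omega> \<in> space M"
      then have "(\<lambda>n. X n \<omega>) \<longlonglongrightarrow> B (stop_time B U N \<omega>) \<omega>"
        unfolding X_def h_def by (intro stopped_tendsto U N)
      then show "(\<lambda>n. f (X n \<omega>)) \<longlonglongrightarrow> f (B (stop_time B U N \<omega>) \<omega>)"
        unfolding f_def by (intro tendsto_intros)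
    qed
    show "AE \<omega> in M. norm (f (B (stop_time B U N \<omega>) \<omega>)) \<le> 1"
      using AE_stop_time_in_closure[OF U a N]
    proof eventually_elim
      case (elim \<omega>)
      have "closure U \<subseteq> {z. 0 \<le> Im z}"
        using up by (intro closure_minimal closed_Collect_le continuous_intros) auto
      then show ?case using elim by (intro f_le) auto
    qed
    show "integrable M (\<lambda>\<omega>. (norm (f (X n \<omega>)))\<^sup>2)" for n
      unfolding nf2 X_def by (intro integrable_Re E2(1))
    show "expectation (\<lambda>\<omega>. (norm (f (X n \<omega>)))\<^sup>2) \<le> 1 + exp (2 * l\<^sup>2 * N)" for n
    proof -
      define x where "x = exp (2 * l\<^sup>2 * h n) - 1"
      have x: "0 \<le> x" using h[of n] by (simp add: x_def)
      \<comment> \<open>Bernoulli's inequality makes the bound independent of the mesh\<close>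
      have "1 + real (Suc n) * x \<le> (1 + x) ^ Suc n" using x by (intro Bernoulli_inequality) simp
      also have "(1 + x) ^ Suc n = exp (2 * l\<^sup>2 * N)"
        unfolding x_def by (simp add: exp_of_nat_mult[symmetric] h_def del: power_Suc of_nat_Suc)
      finally have x2: "real (Suc n) * x \<le> exp (2 * l\<^sup>2 * N)" by simp
      have "norm (complex_of_real (exp (2 * l\<^sup>2 * h n)) - 1) = x"
      proof -
        have "complex_of_real (exp (2 * l\<^sup>2 * h n)) - 1 = complex_of_real x" by (simp add: x_def)
        then show ?thesis using x by (simp only: norm_of_real abs_of_nonneg)
      qed
      then have "norm (expectation (\<lambda>\<omega>. f2 (X n \<omega>)) - f2 a) \<le> exp (2 * l\<^sup>2 * N)"
        using E2(2)[of n "Suc n"] x2 by (simp add: X_def)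
      moreover have "norm (f2 a) \<le> 1" using a up by (intro f2_le) auto
      moreover have "norm (expectation (\<lambda>\<omega>. f2 (X n \<omega>))) \<le> norm (expectation (\<lambda>\<omega>. f2 (X n \<omega>)) - f2 a) + norm (f2 a)"
        using norm_triangle_ineq[of "expectation (\<lambda>\<omega>. f2 (X n \<omega>)) - f2 a" "f2 a"] by simp
      moreover have "Re (expectation (\<lambda>\<omega>. f2 (X n \<omega>))) \<le> norm (expectation (\<lambda>\<omega>. f2 (X n \<omega>)))"
        by (rule complex_Re_le_cmod)
      moreover have "expectation (\<lambda>\<omega>. (norm (f (X n \<omega>)))\<^sup>2) = Re (expectation (\<lambda>\<omega>. f2 (X n \<omega>)))"
        unfolding nf2 X_def by (rule integral_Re[OF E2(1)])
      ultimately show ?thesis by linarith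
    qed
  qed
  then have "expectation (\<lambda>\<omega>. f (B (stop_time B U N \<omega>) \<omega>)) = f a"
    unfolding Ef by (simp add: LIMSEQ_const_iff)
  then show ?thesis by (simp add: f_def)
qed

text \<open>Survival up to time \<open>t\<close> confines a Gaussian variable of variance \<open>t\<close> to an interval of
  length 2.\<close>

lemma prob_survival_le:
  assumes U: "open U" and bd: "U \<subseteq> {z. \<bar>Re z\<bar> < 1}" and t: "0 < t"
  shows "prob (survival U t) \<le> 2 / sqrt (2 * pi * t)"
proof -
  let ?X = "\<lambda>\<omega>. Re (B t \<omega> - B 0 \<omega>)"
  define A where "A = {-1 - Re a..1 - Re a}"
  have D: "distributed M lborel ?X (normal_density 0 (sqrt (t - 0)))"
    using t by (intro Re_increment) auto
  have Am: "A \<in> sets lborel" by (simp add: A_def)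
  have [measurable]: "?X \<in> borel_measurable M" using distributed_measurable[OF D] by simp
  have "emeasure M (survival U t) \<le> emeasure M (?X -` A \<inter> space M)"
  proof (rule emeasure_mono_AE)
    show "AE \<omega> in M. \<omega> \<in> survival U t \<longrightarrow> \<omega> \<in> ?X -` A \<inter> space M"
      using start AE_space
    proof eventually_elim
      case (elim \<omega>)
      show ?case
      proof
        assume "\<omega> \<in> survival U t"
        then have "B t \<omega> \<in> U" using t by (auto simp: survival_def)
        then have "\<bar>Re (B t \<omega>)\<bar> < 1" using bd by blast
        then show "\<omega> \<in> ?X -` A \<inter> space M" using elim by (auto simp: A_def)
      qed
    qed
    show "?X -` A \<inter> space M \<in> events" using Am by measurable
  qed
  also have "\<dots> = (\<integral>\<^sup>+x. ennreal (normal_density 0 (sqrt (t - 0)) x) * indicator A x \<partial>lborel)"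
    by (rule distributed_emeasure[OF D Am])
  also have "\<dots> \<le> (\<integral>\<^sup>+x. ennreal (1 / sqrt (2 * pi * t)) * indicator A x \<partial>lborel)"
  proof (intro nn_integral_mono mult_right_mono ennreal_leI)
    fix x :: real
    have "normal_density 0 (sqrt (t - 0)) x = 1 / sqrt (2 * pi * t) * exp (- x\<^sup>2 / (2 * t))"
      using t by (simp add: normal_density_def)
    also have "\<dots> \<le> 1 / sqrt (2 * pi * t) * 1" using t by (intro mult_left_mono) auto
    finally show "normal_density 0 (sqrt (t - 0)) x \<le> 1 / sqrt (2 * pi * t)" by simp
  qed simp
  also have "\<dots> = ennreal (1 / sqrt (2 * pi * t)) * emeasure lborel A"
    by (rule nn_integral_cmult_indicator[OF Am])
  also have "emeasure lborel A = 2" by (simp add: A_def)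
  also have "ennreal (1 / sqrt (2 * pi * t)) * 2 = ennreal (2 / sqrt (2 * pi * t))"
    using t by (simp add: ennreal_mult[symmetric] flip: ennreal_numeral)
  finally show ?thesis using t by (simp add: emeasure_eq_measure)
qed

lemma infinite_exit_time_eq:
  assumes U: "open U"
  shows "{\<omega> \<in> space M. \<not> exit_time B U \<omega> < \<infinity>} = (\<Inter>n. survival U (real n))"
proof (intro equalityI subsetI)
  fix \<omega> assume \<omega>: "\<omega> \<in> {\<omega> \<in> space M. \<not> exit_time B U \<omega> < \<infinity>}"
  then have sp: "\<omega> \<in> space M" and inf: "exit_time B U \<omega> = \<infinity>" by auto
  have "\<forall>s\<in>{0..real n}. B s \<omega> \<in> U" for n
    using exit_time_gt_iff[OF U, of B \<omega> "real n", OF continuous_paths[OF sp]] inf by simp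
  then show "\<omega> \<in> (\<Inter>n. survival U (real n))" using sp unfolding survival_def by blast
next
  fix \<omega> assume \<omega>: "\<omega> \<in> (\<Inter>n. survival U (real n))"
  then have sp: "\<omega> \<in> space M" by (auto simp: survival_def)
  have "\<forall>s\<in>{0..real n}. B s \<omega> \<in> U" for n using \<omega> unfolding survival_def by blast
  then have gt: "ereal (real n) < exit_time B U \<omega>" for n
    using exit_time_gt_iff[OF U, of B \<omega> "real n", OF continuous_paths[OF sp]] by simp
  have "\<not> exit_time B U \<omega> < \<infinity>"
  proof
    assume "exit_time B U \<omega> < \<infinity>"
    then obtain n where "exit_time B U \<omega> < ereal (real n)"
      using less_PInf_Ex_of_nat by auto
    then show False using gt[of n] by simp
  qed
  then show "\<omega> \<in> {\<omega> \<in> space M. \<not> exit_time B U \<omega> < \<infinity>}" using sp by simp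
qed

lemma infinite_exit_time_events:
  assumes U: "open U"
  shows "{\<omega> \<in> space M. \<not> exit_time B U \<omega> < \<infinity>} \<in> events"
  unfolding infinite_exit_time_eq[OF U]
  by (intro sets.countable_INT) (auto intro!: survival_events U)

lemma AE_exit_time_finite:
  assumes U: "open U" and bd: "U \<subseteq> {z. \<bar>Re z\<bar> < 1}"
  shows "AE \<omega> in M. exit_time B U \<omega> < \<infinity>"
proof -
  let ?S = "{\<omega> \<in> space M. \<not> exit_time B U \<omega> < \<infinity>}"
  have le: "prob ?S \<le> 2 / sqrt (2 * pi * real (Suc n))" for n
  proof -
    have "prob ?S \<le> prob (survival U (real (Suc n)))"
      unfolding infinite_exit_time_eq[OF U] by (intro finite_measure_mono survival_events U INT_lower) simp_all
    also have "\<dots> \<le> 2 / sqrt (2 * pi * real (Suc n))" by (intro prob_survival_le U bd) simp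
    finally show ?thesis .
  qed
  have "(\<lambda>n. 2 / sqrt (2 * pi * real (Suc n))) \<longlonglongrightarrow> 0" by real_asymp
  then have "prob ?S \<le> 0" using le by (intro LIMSEQ_le_const) auto
  then have "emeasure M ?S = 0" by (simp add: emeasure_eq_measure measure_le_0_iff)
  then show ?thesis using infinite_exit_time_events[OF U] by (intro AE_I'[of ?S]) auto
qed

text \<open>Where the exit time is infinite, the exit point is an artefact of totality; the value 0
  keeps the variable measurable.\<close>

definition exit_value :: "complex set \<Rightarrow> 'w \<Rightarrow> complex" where
  "exit_value U \<omega> = (if exit_time B U \<omega> < \<infinity> then exit_point B U \<omega> else 0)"

lemma stop_time_eventually_exit:
  assumes "\<omega> \<in> space M" "open U" "exit_time B U \<omega> < \<infinity>"
  shows "\<forall>\<^sub>F n in sequentially. B (stop_time B U (real (Suc n)) \<omega>) \<omega> = exit_value U \<omega>"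
proof -
  obtain m where m: "exit_time B U \<omega> < ereal (real m)"
    using assms(3) less_PInf_Ex_of_nat by auto
  have "stop_time B U (real (Suc n)) \<omega> = real_of_ereal (exit_time B U \<omega>)" if "n \<ge> m" for n
  proof -
    have "ereal (real m) \<le> ereal (real (Suc n))" using that by simp
    then have "exit_time B U \<omega> \<le> ereal (real (Suc n))" using m by (meson less_imp_le order_trans)
    then show ?thesis by (simp add: stop_time_def min_absorb1)
  qed
  then show ?thesis
    unfolding exit_value_def exit_point_def eventually_sequentially if_P[OF assms(3)]
    by (intro exI[of _ m]) (simp del: of_nat_Suc)
qed

lemma measurable_exit_value:
  assumes U: "open U"
  shows "exit_value U \<in> borel_measurable M"
proof (rule borel_measurable_LIMSEQ_metric)
  let ?S = "{\<omega> \<in> space M. \<not> exit_time B U \<omega> < \<infinity>}"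
  let ?Y = "\<lambda>n \<omega>. if \<omega> \<in> ?S then 0 else B (stop_time B U (real (Suc n)) \<omega>) \<omega>"
  show "?Y n \<in> borel_measurable M" for n
    using infinite_exit_time_events[OF U]
    by (intro measurable_If_set measurable_stop_time U) auto
  show "(\<lambda>n. ?Y n \<omega>) \<longlonglongrightarrow> exit_value U \<omega>" if \<omega>: "\<omega> \<in> space M" for \<omega>
  proof (cases "exit_time B U \<omega> < \<infinity>")
    case True
    then show ?thesis using stop_time_eventually_exit[OF \<omega> U True] 
      by (intro tendsto_eventually) simp
  next
    case False
    then show ?thesis using \<omega> by (simp add: exit_value_def)
  qed
qed

lemma AE_exit_value_frontier:
  assumes U: "open U" and a: "a \<in> U" and bd: "U \<subseteq> {z. \<bar>Re z\<bar> < 1}"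
  shows "AE \<omega> in M. exit_value U \<omega> \<in> frontier U"
proof -
  have "AE \<omega> in M. \<forall>n. B (stop_time B U (real (Suc n)) \<omega>) \<omega> \<in> closure U"
    unfolding AE_all_countable by (intro allI AE_stop_time_in_closure U a) simp
  then show ?thesis
    using AE_exit_time_finite[OF U bd] AE_space
  proof eventually_elim
    case (elim \<omega>)
    from eventually_happens[OF stop_time_eventually_exit[OF elim(3) U elim(2)]]
    have "exit_value U \<omega> \<in> closure U" using elim(1) by (metis sequentially_bot)
    moreover have "exit_value U \<omega> \<notin> U"
      using exit_time_finite(3)[OF U, of B \<omega>, OF continuous_paths[OF elim(3)] elim(2)] elim(2)
      by (simp add: exit_value_def exit_point_def)
    ultimately show ?case using U by (simp add: frontier_def interior_open)
  qed
qed

text \<open>Up to the exit the exponential is bounded by 1, so the time horizon may tend to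
  infinity by dominated convergence.\<close>

lemma expectation_exp_exit:
  assumes U: "open U" and a: "a \<in> U" and up: "U \<subseteq> {z. 0 < Im z}"
    and bd: "U \<subseteq> {z. \<bar>Re z\<bar> < 1}" and l: "0 \<le> l"
  shows "has_bochner_integral M (\<lambda>\<omega>. exp (\<i> * complex_of_real l * exit_value U \<omega>)) (exp (\<i> * complex_of_real l * a))"
proof -
  define f where "f z = exp (\<i> * complex_of_real l * z)" for z
  have fm[measurable]: "f \<in> borel_measurable borel" unfolding f_def
    by (intro borel_measurable_continuous_onI continuous_intros)
  have "closure U \<subseteq> {z. 0 \<le> Im z}"
    using up by (intro closure_minimal closed_Collect_le continuous_intros) auto
  then have f_le: "norm (f z) \<le> 1" if "z \<in> closure U" for z
    using that l by (auto simp: f_def norm_exp_eq_Re)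
  have m1: "(\<lambda>\<omega>. f (exit_value U \<omega>)) \<in> borel_measurable M"
    by (rule measurable_compose[OF measurable_exit_value[OF U] fm])
  have m2: "(\<lambda>\<omega>. f (B (stop_time B U (real (Suc n)) \<omega>) \<omega>)) \<in> borel_measurable M" for n
    by (rule measurable_compose[OF measurable_stop_time[OF U] fm]) simp
  have b1: "AE \<omega> in M. norm (f (B (stop_time B U (real (Suc n)) \<omega>) \<omega>)) \<le> 1" for n
  proof -
    have "AE \<omega> in M. B (stop_time B U (real (Suc n)) \<omega>) \<omega> \<in> closure U"
      by (intro AE_stop_time_in_closure U a) simp
    then show ?thesis by eventually_elim (rule f_le)
  qed
  have lim: "AE \<omega> in M. (\<lambda>n. f (B (stop_time B U (real (Suc n)) \<omega>) \<omega>)) \<longlonglongrightarrow> f (exit_value U \<omega>)"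
    using AE_exit_time_finite[OF U bd] AE_space
  proof eventually_elim
    case (elim \<omega>)
    show ?case
      using stop_time_eventually_exit[OF elim(2) U elim(1)]
      by (intro tendsto_eventually) (auto elim: eventually_mono)
  qed
  have "integrable M (\<lambda>\<omega>. f (exit_value U \<omega>))"
    by (rule integrable_dominated_convergence[where w="\<lambda>_. 1", OF m1 m2 _ lim b1]) simp
  moreover have "(\<lambda>n. expectation (\<lambda>\<omega>. f (B (stop_time B U (real (Suc n)) \<omega>) \<omega>))) \<longlonglongrightarrow> expectation (\<lambda>\<omega>. f (exit_value U \<omega>))"
    by (rule integral_dominated_convergence[where w="\<lambda>_. 1", OF m1 m2 _ lim b1]) simp
  moreover have "expectation (\<lambda>\<omega>. f (B (stop_time B U (real (Suc n)) \<omega>) \<omega>)) = f a" for n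
    unfolding f_def by (intro expectation_exp_stopped U a up l) simp
  ultimately have "integrable M (\<lambda>\<omega>. f (exit_value U \<omega>))" "expectation (\<lambda>\<omega>. f (exit_value U \<omega>)) = f a"
    by (simp_all add: LIMSEQ_const_iff)
  then show ?thesis by (simp add: has_bochner_integral_iff f_def)
qed

end

section \<open>The exit law of the half-strip on its base\<close>

lemma half_strip_topology:
  shows "open half_strip" "closure half_strip \<subseteq> {z. \<bar>Re z\<bar> \<le> 1 \<and> 0 \<le> Im z}"
    "half_strip \<subseteq> {z. 0 < Im z}" "half_strip \<subseteq> {z. \<bar>Re z\<bar> < 1}"
proof -
  show "open half_strip" unfolding half_strip_def
    by (intro open_Collect_conj open_Collect_less continuous_intros)
  have "closed {z. \<bar>Re z\<bar> \<le> 1 \<and> 0 \<le> Im z}"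
    by (intro closed_Collect_conj closed_Collect_le continuous_intros)
  then show "closure half_strip \<subseteq> {z. \<bar>Re z\<bar> \<le> 1 \<and> 0 \<le> Im z}"
    by (intro closure_minimal) (auto simp: half_strip_def)
  show "half_strip \<subseteq> {z. 0 < Im z}" "half_strip \<subseteq> {z. \<bar>Re z\<bar> < 1}" by (auto simp: half_strip_def)
qed

lemma real_segment_frontier_half_strip:
  assumes "-1 < x" "x < 1"
  shows "complex_of_real x \<in> frontier half_strip"
proof -
  have "(\<lambda>n. Complex x (inverse (real (Suc n)))) \<longlonglongrightarrow> Complex x 0"
    by (intro tendsto_Complex tendsto_const LIMSEQ_inverse_real_of_nat)
  moreover have "Complex x (inverse (real (Suc n))) \<in> half_strip" for n
    using assms by (simp add: half_strip_def)
  ultimately have "Complex x 0 \<in> closure half_strip"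
    using closed_sequentially[OF closed_closure, of "\<lambda>n. Complex x (inverse (real (Suc n)))" half_strip]
      closure_subset by blast
  then show ?thesis
    using half_strip_topology(1) by (simp add: frontier_def interior_open half_strip_def complex_of_real_def)
qed

text \<open>With \<open>l = k\<pi>/2\<close> and the phase shift \<open>exp (i l)\<close>, the imaginary part of the exponential is the
  harmonic function that vanishes on both vertical sides of the half-strip and equals the
  \<open>k\<close>-th sine on its base.\<close>

lemma Im_exp_strip:
  "Im (exp (\<i> * complex_of_real (real k * pi / 2)) * exp (\<i> * complex_of_real (real k * pi / 2) * z)) =
     exp (- (real k * pi / 2) * Im z) * sin (real k * strip_angle (Re z))"
proof -
  have "\<i> * complex_of_real (real k * pi / 2) + \<i> * complex_of_real (real k * pi / 2) * z =
      Complex (- (real k * pi / 2) * Im z) (real k * strip_angle (Re z))"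
    by (simp add: complex_eq_iff strip_angle_def field_simps)
  then show ?thesis by (simp only: exp_add[symmetric] Im_exp complex.sel)
qed

context planar_brownian_motion
begin

definition segment_exit :: "'w set" where
  "segment_exit = {\<omega> \<in> space M. exit_time B half_strip \<omega> < \<infinity> \<and>
     Im (exit_value half_strip \<omega>) = 0 \<and> \<bar>Re (exit_value half_strip \<omega>)\<bar> < 1}"

definition segment_exit_law :: "real measure" where
  "segment_exit_law = distr (density M (indicator segment_exit)) borel (\<lambda>\<omega>. Re (exit_value half_strip \<omega>))"

lemma segment_exit_events [measurable]: "segment_exit \<in> events"
proof -
  have [measurable]: "exit_value half_strip \<in> borel_measurable M"
    by (rule measurable_exit_value[OF half_strip_topology(1)])
  have "{\<omega> \<in> space M. Im (exit_value half_strip \<omega>) = 0 \<and> \<bar>Re (exit_value half_strip \<omega>)\<bar> < 1} -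
      {\<omega> \<in> space M. \<not> exit_time B half_strip \<omega> < \<infinity>} \<in> events"
    using infinite_exit_time_events[OF half_strip_topology(1)] by measurable
  moreover have "{\<omega> \<in> space M. Im (exit_value half_strip \<omega>) = 0 \<and> \<bar>Re (exit_value half_strip \<omega>)\<bar> < 1} -
      {\<omega> \<in> space M. \<not> exit_time B half_strip \<omega> < \<infinity>} = segment_exit"
    unfolding segment_exit_def by blast
  ultimately show ?thesis by (simp only:)
qed

lemma measurable_Re_exit_value [measurable]: "(\<lambda>\<omega>. Re (exit_value half_strip \<omega>)) \<in> borel_measurable M"
  using measurable_exit_value[OF half_strip_topology(1)] by measurable

lemma emeasure_segment_exit_law:
  assumes [measurable]: "A \<in> sets borel"
  shows "emeasure segment_exit_law A = emeasure M {\<omega> \<in> segment_exit. Re (exit_value half_strip \<omega>) \<in> A}"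
proof -
  have "emeasure segment_exit_law A =
      (\<integral>\<^sup>+\<omega>. indicator segment_exit \<omega> * indicator ((\<lambda>\<omega>. Re (exit_value half_strip \<omega>)) -` A \<inter> space M) \<omega> \<partial>M)"
    unfolding segment_exit_law_def by (simp add: emeasure_distr emeasure_density)
  also have "\<dots> = (\<integral>\<^sup>+\<omega>. indicator {\<omega> \<in> segment_exit. Re (exit_value half_strip \<omega>) \<in> A} \<omega> \<partial>M)"
    by (intro nn_integral_cong) (auto simp: indicator_def)
  also have "\<dots> = emeasure M {\<omega> \<in> segment_exit. Re (exit_value half_strip \<omega>) \<in> A}"
  proof -
    have "{\<omega> \<in> segment_exit. Re (exit_value half_strip \<omega>) \<in> A} =
        segment_exit \<inter> ((\<lambda>\<omega>. Re (exit_value half_strip \<omega>)) -` A \<inter> space M)"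
      by (auto simp: segment_exit_def)
    then have "{\<omega> \<in> segment_exit. Re (exit_value half_strip \<omega>) \<in> A} \<in> events" by simp
    then show ?thesis by (rule nn_integral_indicator)
  qed
  finally show ?thesis .
qed

lemma segment_exit_law_props:
  shows "finite_measure segment_exit_law" "sets segment_exit_law = sets borel"
    "AE x in segment_exit_law. x \<in> {-1<..<1}"
proof -
  show s: "sets segment_exit_law = sets borel" by (simp add: segment_exit_law_def)
  have "emeasure segment_exit_law (space segment_exit_law) \<noteq> \<infinity>"
    using emeasure_segment_exit_law[of UNIV] sets_eq_imp_space_eq[OF s] by simp
  then show "finite_measure segment_exit_law" by (rule finite_measureI)
  have "emeasure segment_exit_law (- {-1<..<1}) = 0"
  proof -
    have "{\<omega> \<in> segment_exit. Re (exit_value half_strip \<omega>) \<in> - {-1<..<1}} = {}"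
      by (auto simp: segment_exit_def abs_less_iff)
    then show ?thesis by (subst emeasure_segment_exit_law) (simp, simp only: emeasure_empty)
  qed
  then show "AE x in segment_exit_law. x \<in> {-1<..<1}"
    by (intro AE_I'[of "- {-1<..<1}"]) (auto simp: s)
qed

text \<open>The harmonic function with boundary values \<open>sin (k \<theta>)\<close> on the base and 0
  on the sides, evaluated at the starting point. Exits through the sides, corners included,
  contribute nothing.\<close>

lemma segment_exit_law_sine_moments:
  assumes a: "a \<in> half_strip"
  shows "(\<integral>x. sin (real k * strip_angle x) \<partial>segment_exit_law) =
    exp (- (pi * Im a / 2) * real k) * sin (real k * strip_angle (Re a))"
proof -
  let ?X = "exit_value half_strip"
  let ?l = "real k * pi / 2"
  let ?c = "exp (\<i> * complex_of_real ?l)"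
  note top = half_strip_topology
  have "has_bochner_integral M (\<lambda>\<omega>. ?c * exp (\<i> * complex_of_real ?l * ?X \<omega>)) (?c * exp (\<i> * complex_of_real ?l * a))"
    by (intro has_bochner_integral_mult_right expectation_exp_exit top(1,3,4) a) simp
  then have "expectation (\<lambda>\<omega>. Im (?c * exp (\<i> * complex_of_real ?l * ?X \<omega>))) = Im (?c * exp (\<i> * complex_of_real ?l * a))"
    unfolding has_bochner_integral_iff using integral_Im by metis
  then have "expectation (\<lambda>\<omega>. exp (- ?l * Im (?X \<omega>)) * sin (real k * strip_angle (Re (?X \<omega>)))) =
      exp (- ?l * Im a) * sin (real k * strip_angle (Re a))"
    unfolding Im_exp_strip .
  moreover have "expectation (\<lambda>\<omega>. exp (- ?l * Im (?X \<omega>)) * sin (real k * strip_angle (Re (?X \<omega>)))) =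
      expectation (\<lambda>\<omega>. indicator segment_exit \<omega> * sin (real k * strip_angle (Re (?X \<omega>))))"
  proof (rule integral_cong_AE)
    have [measurable]: "?X \<in> borel_measurable M" by (rule measurable_exit_value[OF top(1)])
    have [measurable]: "strip_angle \<in> borel_measurable borel" unfolding strip_angle_def by measurable
    show "(\<lambda>\<omega>. exp (- ?l * Im (?X \<omega>)) * sin (real k * strip_angle (Re (?X \<omega>)))) \<in> borel_measurable M"
      by measurable
    show "(\<lambda>\<omega>. indicator segment_exit \<omega> * sin (real k * strip_angle (Re (?X \<omega>)))) \<in> borel_measurable M"
      by measurable
    show "AE \<omega> in M. exp (- ?l * Im (?X \<omega>)) * sin (real k * strip_angle (Re (?X \<omega>))) =
        indicator segment_exit \<omega> * sin (real k * strip_angle (Re (?X \<omega>)))"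
      using AE_exit_value_frontier[OF top(1) a top(4)] AE_exit_time_finite[OF top(1,4)] AE_space
    proof eventually_elim
      case (elim \<omega>)
      define z where "z = ?X \<omega>"
      have cl: "\<bar>Re z\<bar> \<le> 1" "0 \<le> Im z" and nin: "z \<notin> half_strip"
        using elim(1) top(1,2) by (auto simp: z_def frontier_def interior_open)
      consider "\<bar>Re z\<bar> < 1" "Im z = 0" | "Re z = 1" | "Re z = -1"
        using cl nin by (fastforce simp: half_strip_def abs_less_iff abs_le_iff)
      then show ?case
      proof cases
        case 1
        then show ?thesis using elim by (simp add: z_def segment_exit_def)
      next
        case 2
        then have "sin (real k * strip_angle (Re z)) = 0" by (simp add: strip_angle_def)
        then show ?thesis by (simp add: z_def)
      next
        case 3
        then have "sin (real k * strip_angle (Re z)) = 0" by (simp add: strip_angle_def)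
        then show ?thesis by (simp add: z_def)
      qed
    qed
  qed
  moreover have "(\<integral>x. sin (real k * strip_angle x) \<partial>segment_exit_law) =
      expectation (\<lambda>\<omega>. indicator segment_exit \<omega> * sin (real k * strip_angle (Re (?X \<omega>))))"
  proof -
    have [measurable]: "strip_angle \<in> borel_measurable borel" unfolding strip_angle_def by measurable
    have ind: "(indicator segment_exit :: 'w \<Rightarrow> ennreal) = (\<lambda>\<omega>. ennreal (indicator segment_exit \<omega>))"
      by (simp add: ennreal_indicator)
    show ?thesis
      unfolding segment_exit_law_def ind
      by (subst integral_distr) (auto simp: integral_density)
  qed
  moreover have "- ?l * Im a = - (pi * Im a / 2) * real k" by simp
  ultimately show ?thesis by (simp only:)
qed

lemma segment_exit_law_eq:
  assumes a: "a \<in> half_strip"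
  shows "segment_exit_law = density lborel (\<lambda>x. ennreal (half_strip_kernel (Re a) (Im a) x * indicator {-1<..<1} x))"
    (is "_ = ?N")
proof -
  define p where "p x = half_strip_kernel (Re a) (Im a) x * indicator {-1<..<1} x" for x
  have b: "0 < Im a" and al: "\<bar>Re a\<bar> \<le> 1" "-1 < Re a" "Re a < 1" using a by (auto simp: half_strip_def)
  have [measurable]: "half_strip_kernel (Re a) (Im a) \<in> borel_measurable borel"
    using continuous_half_strip_kernel[OF b] by (rule borel_measurable_continuous_onI)
  have pm[measurable]: "p \<in> borel_measurable borel" unfolding p_def[abs_def] by measurable
  have p0: "0 \<le> p x" for x
    unfolding p_def using half_strip_kernel_nonneg[OF b al(1), of x] by (auto simp: indicator_def)
  \<comment> \<open>the kernel vanishes at both endpoints, by its factor \<open>cos (\<pi> x / 2)\<close>\<close>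
  have closed_eq: "p x = half_strip_kernel (Re a) (Im a) x * indicator {-1..1} x" for x
    by (auto simp: p_def indicator_def half_strip_kernel_def abs_less_iff not_less dest!: antisym)
  have [measurable]: "strip_angle \<in> borel_measurable borel" unfolding strip_angle_def by measurable
  have mom: "has_bochner_integral lborel (\<lambda>x. p x * sin (real k * strip_angle x))
      (exp (- (pi * Im a / 2) * real k) * sin (real k * strip_angle (Re a)))" if "0 < k" for k
    using half_strip_kernel_sine_moments[OF b that, of "Re a"] unfolding closed_eq by (simp add: mult_ac)
  have momN: "(\<integral>x. sin (real k * strip_angle x) \<partial>density lborel (\<lambda>x. ennreal (p x))) =
      exp (- (pi * Im a / 2) * real k) * sin (real k * strip_angle (Re a))" if "0 < k" for k
    using mom[OF that] p0 by (subst integral_density) (auto simp: has_bochner_integral_integral_eq)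
  have ip: "integrable lborel p"
  proof -
    have "integrable lborel (\<lambda>x. indicator {-1..1} x *\<^sub>R half_strip_kernel (Re a) (Im a) x)"
      by (intro borel_integrable_compact continuous_on_subset[OF continuous_half_strip_kernel[OF b]]) auto
    then show ?thesis unfolding closed_eq[abs_def] by (simp add: mult.commute)
  qed
  have "segment_exit_law = density lborel (\<lambda>x. ennreal (p x))"
  proof (rule sine_moments_determine_measure[OF segment_exit_law_props])
    have "emeasure (density lborel (\<lambda>x. ennreal (p x))) (space (density lborel (\<lambda>x. ennreal (p x)))) \<noteq> \<infinity>"
      using ip p0 by (simp add: emeasure_density nn_integral_eq_integral)
    then show "finite_measure (density lborel (\<lambda>x. ennreal (p x)))" by (rule finite_measureI)
    show "sets (density lborel (\<lambda>x. ennreal (p x))) = sets borel" by simp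
    show "AE x in density lborel (\<lambda>x. ennreal (p x)). x \<in> {-1<..<1}"
      by (subst AE_density) (auto simp: p_def indicator_def split: if_splits)
    show "(\<integral>x. sin (real k * strip_angle x) \<partial>segment_exit_law) =
        (\<integral>x. sin (real k * strip_angle x) \<partial>density lborel (\<lambda>x. ennreal (p x)))" if "0 < k" for k
      unfolding momN[OF that] by (rule segment_exit_law_sine_moments[OF a])
    have "sin (strip_angle (Re a)) > 0" using arccos_strip_angle(2)[OF al(2,3)] .
    then show "0 < (\<integral>x. sin (strip_angle x) \<partial>segment_exit_law)"
      using segment_exit_law_sine_moments[OF a, of 1] by simp
  qed
  then show ?thesis by (simp add: p_def)
qed

lemma exit_density_half_strip:
  assumes a: "a \<in> half_strip"
  shows "exit_density M B half_strip complex_of_real {-1<..<1} (\<lambda>z. half_strip_kernel (Re a) (Im a) (Re z))"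
  unfolding exit_density_def
proof (intro conjI ballI impI)
  have b: "0 < Im a" and al: "\<bar>Re a\<bar> \<le> 1" using a by (auto simp: half_strip_def)
  note cont = continuous_half_strip_kernel[OF b, of "Re a"]
  have km[measurable]: "half_strip_kernel (Re a) (Im a) \<in> borel_measurable borel"
    using cont by (rule borel_measurable_continuous_onI)
  show "arclength_parametrization complex_of_real {-1<..<1}"
    unfolding arclength_parametrization_def
  proof (intro conjI ballI)
    fix s :: real
    have "(complex_of_real has_vector_derivative complex_of_real 1) (at s)"
      using bounded_linear.has_vector_derivative[OF bounded_linear_of_real has_vector_derivative_id] .
    then show "\<exists>v. (complex_of_real has_vector_derivative v) (at s) \<and> cmod v = 1" by auto
  qed (auto simp: inj_on_def is_interval_oo)
  show "complex_of_real ` {-1<..<1} \<subseteq> frontier half_strip"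
    using real_segment_frontier_half_strip by auto
  show "continuous_on (complex_of_real ` {-1<..<1}) (\<lambda>z. half_strip_kernel (Re a) (Im a) (Re z))"
    by (intro continuous_on_compose2[OF cont] continuous_intros) auto
  show "0 \<le> half_strip_kernel (Re a) (Im a) (Re z)" if "z \<in> complex_of_real ` {-1<..<1}" for z
    using that half_strip_kernel_nonneg[OF b al] by auto
  fix E :: "complex set" assume E[measurable]: "E \<in> sets borel" and sub: "E \<subseteq> complex_of_real ` {-1<..<1}"
  let ?S = "{\<omega> \<in> space M. exit_time B half_strip \<omega> < \<infinity> \<and> exit_point B half_strip \<omega> \<in> E}"
  define A where "A = complex_of_real -` E"
  have A[measurable]: "A \<in> sets borel"
    unfolding A_def using measurable_sets[of complex_of_real borel borel E] by simp
  have S: "?S = {\<omega> \<in> segment_exit. Re (exit_value half_strip \<omega>) \<in> A}"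
  proof (intro equalityI subsetI)
    fix \<omega> assume \<omega>: "\<omega> \<in> ?S"
    then obtain x where "exit_point B half_strip \<omega> = complex_of_real x" "-1 < x" "x < 1" using sub by auto
    then show "\<omega> \<in> {\<omega> \<in> segment_exit. Re (exit_value half_strip \<omega>) \<in> A}"
      using \<omega> by (auto simp: segment_exit_def exit_value_def A_def)
  next
    fix \<omega> assume \<omega>: "\<omega> \<in> {\<omega> \<in> segment_exit. Re (exit_value half_strip \<omega>) \<in> A}"
    then have "complex_of_real (Re (exit_value half_strip \<omega>)) = exit_value half_strip \<omega>"
      by (auto simp: segment_exit_def complex_eq_iff)
    then show "\<omega> \<in> ?S" using \<omega> by (auto simp: segment_exit_def exit_value_def A_def)
  qed
  show "?S \<in> events"
  proof -
    have "?S = segment_exit \<inter> ((\<lambda>\<omega>. Re (exit_value half_strip \<omega>)) -` A \<inter> space M)"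
      unfolding S by (auto simp: segment_exit_def)
    then show ?thesis by simp
  qed
  have "emeasure M ?S = emeasure segment_exit_law A"
    unfolding S by (rule emeasure_segment_exit_law[symmetric]) (rule A)
  also have "\<dots> = (\<integral>\<^sup>+x. ennreal (half_strip_kernel (Re a) (Im a) x * indicator {-1<..<1} x) * indicator A x \<partial>lborel)"
    unfolding segment_exit_law_eq[OF a] by (rule emeasure_density) auto
  also have "\<dots> = (\<integral>\<^sup>+x. ennreal (half_strip_kernel (Re a) (Im a) x) * indicator E (complex_of_real x) * indicator {-1<..<1} x \<partial>lborel)"
    by (intro nn_integral_cong) (auto simp: indicator_def A_def)
  also have "\<dots> = (\<integral>\<^sup>+x. ennreal (half_strip_kernel (Re a) (Im a) x) * indicator E (complex_of_real x) \<partial>restrict_space lborel {-1<..<1})"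
    by (rule nn_integral_restrict_space[symmetric]) simp
  also have "\<dots> = (\<integral>\<^sup>+z\<in>E. ennreal (half_strip_kernel (Re a) (Im a) (Re z)) \<partial>arclength_measure complex_of_real {-1<..<1})"
    unfolding arclength_measure_def
    by (subst nn_integral_distr) (auto intro!: measurable_restrict_space1)
  finally show "emeasure M ?S = (\<integral>\<^sup>+z\<in>E. ennreal (half_strip_kernel (Re a) (Im a) (Re z)) \<partial>arclength_measure complex_of_real {-1<..<1})" .
qed

end

theorem mainTheorem9:
  fixes M :: "'w measure" and B :: "real \<Rightarrow> 'w \<Rightarrow> complex" and \<alpha> \<beta> :: real
  assumes "-1 < \<alpha>" and "\<alpha> < 1" and "0 < \<beta>"
    and "planar_brownian_motion M B (Complex \<alpha> \<beta>)"
  shows "\<exists>\<rho>. exit_density M B half_strip complex_of_real {-1<..<1} \<rho> \<and>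
    (\<forall>x::real. -1 < x \<and> x < 1 \<longrightarrow>
      (\<lambda>n::int. (-1) powi n * (\<beta> / (\<beta>^2 + (\<alpha> - (2 * real_of_int n + (-1) powi n * x))^2)))
        summable_on UNIV \<and>
      \<rho> (complex_of_real x) =
        1 / pi * (\<Sum>\<^sub>\<infinity>n::int. (-1) powi n *
          (\<beta> / (\<beta>^2 + (\<alpha> - (2 * real_of_int n + (-1) powi n * x))^2))) \<and>
      \<rho> (complex_of_real x) =
        1 / 2 * (sinh (pi * \<beta> / 2) * cos (pi * \<alpha> / 2) * cos (pi * x / 2) /
          ((sinh (pi * \<beta> / 2))^2 + (sin (pi * \<alpha> / 2))^2 + (sin (pi * x / 2))^2
            - 2 * cosh (pi * \<beta> / 2) * sin (pi * \<alpha> / 2) * sin (pi * x / 2))))"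
proof (intro exI[of _ "\<lambda>z. half_strip_kernel \<alpha> \<beta> (Re z)"] conjI allI impI)
  have "Complex \<alpha> \<beta> \<in> half_strip" using assms(1-3) by (simp add: half_strip_def)
  from planar_brownian_motion.exit_density_half_strip[OF assms(4) this]
  show "exit_density M B half_strip complex_of_real {-1<..<1} (\<lambda>z. half_strip_kernel \<alpha> \<beta> (Re z))"
    by simp
  fix x :: real
  note series = has_sum_reflected_cauchy_kernel[OF assms(3), of \<alpha> x]
  show "(\<lambda>n::int. (-1) powi n * (\<beta> / (\<beta>^2 + (\<alpha> - (2 * real_of_int n + (-1) powi n * x))^2)))
        summable_on UNIV"
    using series by (rule has_sum_imp_summable)
  show "half_strip_kernel \<alpha> \<beta> (Re (complex_of_real x)) =
        1 / pi * (\<Sum>\<^sub>\<infinity>n::int. (-1) powi n *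
          (\<beta> / (\<beta>^2 + (\<alpha> - (2 * real_of_int n + (-1) powi n * x))^2)))"
    unfolding infsumI[OF series] by simp
  show "half_strip_kernel \<alpha> \<beta> (Re (complex_of_real x)) =
        1 / 2 * (sinh (pi * \<beta> / 2) * cos (pi * \<alpha> / 2) * cos (pi * x / 2) /
          ((sinh (pi * \<beta> / 2))^2 + (sin (pi * \<alpha> / 2))^2 + (sin (pi * x / 2))^2
            - 2 * cosh (pi * \<beta> / 2) * sin (pi * \<alpha> / 2) * sin (pi * x / 2)))"
    by (simp add: half_strip_kernel_def)
qed

end
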